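(* Let $V$ be an infinite-dimensional AM-algebra with unit $\mathbf{e}$, let $\operatorname{int}(V_+)$ be the norm interior of $V_+$, and let $\tilde\rho:\operatorname{int}(V_+)\to(0,\infty]$ be a proper map (not identically $\infty$). Then $\tilde\rho$ is a GG-convex return risk measure if and only if it admits the representation $$\tilde\rho(x)=\max_{l\in L}\frac{l(x)}{\tilde a(l)},\qquad x\in\operatorname{int}(V_+),$$ where $$L=\Big\{l_c\cdot l_s\ \Big|\ l_c\in V^{GG,\sim}_{n,+},\ l_s\in V^{GG,\sim}_{s,+},\ \sup_{x\ge\mathbf{e},\ \|\log(x)\|_{\mathbf{e}}=1}\big(l_c(x)l_s(x)\big)=e\Big\}$$ ($e$ being Euler's number) and $\tilde a:L\to(0,\infty]$ is given by $$\tilde a(l)=\sup_{x\in\operatorname{int}(V_+)}\frac{l(x)}{\tilde\rho(x)}=\sup_{x\in\mathcal{B}_{\tilde\rho}}l(x),\qquad l\in L,$$ with $\mathcal{B}_{\tilde\rho}=\{x\in\operatorname{int}(V_+):\tilde\rho(x)\le1\}$.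
   Context: An AM-space with unit $\mathbf{e}$ is a Banach lattice $V$ with order unit $\mathbf{e}$ (i.e. $\mathbf{e}>0$ and for every $x$ there is $\lambda>0$ with $|x|\le\lambda\mathbf{e}$) equipped with the norm $\|x\|_{\mathbf{e}}=\inf\{\lambda>0:|x|\le\lambda\mathbf{e}\}$; $V_+=\{x:x\ge0\}$. An AM-algebra with unit $\mathbf{e}$ is an AM-space with unit $\mathbf{e}$ that is also a real associative algebra such that products of positive elements are positive, the norm is submultiplicative, and $\mathbf{e}$ is also the multiplicative identity. There are a compact Hausdorff $K$ and a surjective lattice and algebra isometry $\Phi:V\to C(K)$ (pointwise operations) with $\Phi(\mathbf{e})=\mathbf{1}_K$; functions of elements are defined through it: $\exp(x)=\Phi^{-1}(\exp\circ\Phi(x))$, $x^t=\Phi^{-1}((\Phi(x))^t)$ for $x\in V_+,t\ge0$. The map $\exp:V\to\operatorname{int}(V_+)$ is a bijection with inverse $\log$. A return risk measure is a map $\tilde\rho:\operatorname{int}(V_+)\to(0,\infty]$ that is monotone and positively homogeneous ($\tilde\rho(\lambda x)=\lambda\tilde\rho(x)$, $\lambda>0$). It is GG-convex if $\tilde\rho(x^\lambda y^{1-\lambda})\le\tilde\rho(x)^\lambda\tilde\rho(y)^{1-\lambda}$ for all $x,y$, $\lambda\in(0,1)$. $V^\sim$ is the order dual of $V$ (order bounded linear functionals), $V_n^\sim\subseteq V^\sim$ the order continuous dual, and $V_s^\sim=\{\psi\in V^\sim: |\psi|\wedge|\varphi|=0\ \forall\varphi\in V_n^\sim\}$ its disjoint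 complement; subscript $+$ denotes positive functionals. Define $V^{GG,\sim}_{n,+}=\{l:\operatorname{int}(V_+)\to(0,\infty)\mid\log\circ l\circ\exp\in(V_n^\sim)_+\}$ and $V^{GG,\sim}_{s,+}=\{l:\operatorname{int}(V_+)\to(0,\infty)\mid\log\circ l\circ\exp\in(V_s^\sim)_+\}$; $l_c\cdot l_s$ is the pointwise product. Quotients with denominator $\infty$ are $0$. *)

theory Defs
  imports "HOL-Analysis.Analysis" "HOL-Library.Lattice_Algebras"
begin

class banach_lattice = banach + ordered_real_vector + lattice_ab_group_add_abs +
  assumes norm_lattice: "\<bar>x\<bar> \<le> \<bar>y\<bar> \<Longrightarrow> norm x \<le> norm y"

text \<open>
  AM-algebras with unit. The element \<open>1\<close> is both the multiplicative identity and the order unit.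
  The superclass \<^class>\<open>lattice_ring\<close> says that products of positive elements are positive, and
  \<^class>\<open>real_normed_algebra_1\<close> that the norm is submultiplicative.
\<close>

class am_algebra = banach_lattice + lattice_ring + real_normed_algebra_1 +
  assumes unit_pos: "0 < 1"
    and order_unit: "\<exists>c>0. \<bar>x\<bar> \<le> c *\<^sub>R 1"
    and norm_order_unit: "norm x = Inf {c. 0 < c \<and> \<bar>x\<bar> \<le> c *\<^sub>R 1}"

definition int_cone :: "'v::am_algebra set" where
  "int_cone = interior {x. 0 \<le> x}"

section \<open>Functional calculus\<close>

definition C_space :: "'k topology \<Rightarrow> ('k \<Rightarrow> real) set" where
  "C_space K = {f \<in> extensional (topspace K). continuous_map K euclideanreal f}"

definition am_representation :: "'k topology \<Rightarrow> ('v::am_algebra \<Rightarrow> 'k \<Rightarrow> real) \<Rightarrow> bool" where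
  "am_representation K \<Phi> \<longleftrightarrow>
     compact_space K \<and> Hausdorff_space K \<and> range \<Phi> = C_space K \<and>
     (\<forall>x y. \<forall>k\<in>topspace K. \<Phi> (x + y) k = \<Phi> x k + \<Phi> y k) \<and>
     (\<forall>c x. \<forall>k\<in>topspace K. \<Phi> (c *\<^sub>R x) k = c * \<Phi> x k) \<and>
     (\<forall>x y. \<forall>k\<in>topspace K. \<Phi> (x * y) k = \<Phi> x k * \<Phi> y k) \<and>
     (\<forall>x y. \<forall>k\<in>topspace K. \<Phi> (sup x y) k = max (\<Phi> x k) (\<Phi> y k)) \<and>
     (\<forall>x y. \<forall>k\<in>topspace K. \<Phi> (inf x y) k = min (\<Phi> x k) (\<Phi> y k)) \<and>
     (\<forall>k\<in>topspace K. \<Phi> 1 k = 1) \<and>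
     (\<forall>x. norm x = (SUP k\<in>topspace K. \<bar>\<Phi> x k\<bar>))"

text \<open>
  Using functions \<open>'v \<Rightarrow> real\<close> as the points of \<open>K\<close> loses no generality: for every representation
  \<open>(K, \<Phi>)\<close> the map \<open>k \<mapsto> (\<lambda>x. \<Phi> x k)\<close> is a homeomorphism of \<open>K\<close> onto a compact space of such
  functions. The calculus does not depend on the chosen representation.
\<close>

definition am_rep :: "('v \<Rightarrow> real) topology \<times> ('v::am_algebra \<Rightarrow> ('v \<Rightarrow> real) \<Rightarrow> real)" where
  "am_rep = (SOME (K, \<Phi>). am_representation K \<Phi>)"

definition am_calculus :: "(real \<Rightarrow> real) \<Rightarrow> 'v::am_algebra \<Rightarrow> 'v" where
  "am_calculus g x = (let (K, \<Phi>) = am_rep in inv \<Phi> (\<lambda>k\<in>topspace K. g (\<Phi> x k)))"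

definition am_exp :: "'v::am_algebra \<Rightarrow> 'v" where
  "am_exp = am_calculus exp"

definition am_log :: "'v::am_algebra \<Rightarrow> 'v" where
  "am_log = inv am_exp"

text \<open>The case distinction gives \<open>r\<^sup>0 = 1\<close> also at \<open>r = 0\<close>, where \<open>0 powr 0 = 0\<close>.\<close>

definition am_power :: "'v::am_algebra \<Rightarrow> real \<Rightarrow> 'v" where
  "am_power x t = am_calculus (\<lambda>r. if t = 0 then 1 else r powr t) x"

section \<open>Return risk measures\<close>

definition return_risk_measure :: "('v::am_algebra \<Rightarrow> ereal) \<Rightarrow> bool" where
  "return_risk_measure \<rho> \<longleftrightarrow>
     (\<forall>x\<in>int_cone. 0 < \<rho> x) \<and>
     (\<forall>x\<in>int_cone. \<forall>y\<in>int_cone. x \<le> y \<longrightarrow> \<rho> x \<le> \<rho> y) \<and>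
     (\<forall>x\<in>int_cone. \<forall>c>0. \<rho> (c *\<^sub>R x) = ereal c * \<rho> x)"

text \<open>Powers with positive exponent of elements of \<open>(0,\<infinity>]\<close>.\<close>

definition ereal_power :: "ereal \<Rightarrow> real \<Rightarrow> ereal" where
  "ereal_power a t = (if a = \<infinity> then \<infinity> else ereal (real_of_ereal a powr t))"

definition GG_convex :: "('v::am_algebra \<Rightarrow> ereal) \<Rightarrow> bool" where
  "GG_convex \<rho> \<longleftrightarrow>
     (\<forall>x\<in>int_cone. \<forall>y\<in>int_cone. \<forall>t::real. 0 < t \<and> t < 1 \<longrightarrow>
        \<rho> (am_power x t * am_power y (1 - t))
          \<le> ereal_power (\<rho> x) t * ereal_power (\<rho> y) (1 - t))"

definition acceptance_set :: "('v::am_algebra \<Rightarrow> ereal) \<Rightarrow> 'v set" where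
  "acceptance_set \<rho> = {x \<in> int_cone. \<rho> x \<le> 1}"

section \<open>The order dual\<close>

definition order_dual :: "('v::banach_lattice \<Rightarrow> real) set" where
  "order_dual = {f. linear f \<and> (\<forall>a b. bounded (f ` {a..b}))}"

definition pos_functional :: "('v::banach_lattice \<Rightarrow> real) \<Rightarrow> bool" where
  "pos_functional f \<longleftrightarrow> (\<forall>x\<ge>0. 0 \<le> f x)"

definition dual_le :: "('v::banach_lattice \<Rightarrow> real) \<Rightarrow> ('v \<Rightarrow> real) \<Rightarrow> bool" where
  "dual_le f g \<longleftrightarrow> (\<forall>x\<ge>0. f x \<le> g x)"

definition dual_sup :: "('v::banach_lattice \<Rightarrow> real) \<Rightarrow> ('v \<Rightarrow> real) \<Rightarrow> 'v \<Rightarrow> real" where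
  "dual_sup f g = (THE h. h \<in> order_dual \<and> dual_le f h \<and> dual_le g h \<and>
     (\<forall>k\<in>order_dual. dual_le f k \<and> dual_le g k \<longrightarrow> dual_le h k))"

definition dual_inf :: "('v::banach_lattice \<Rightarrow> real) \<Rightarrow> ('v \<Rightarrow> real) \<Rightarrow> 'v \<Rightarrow> real" where
  "dual_inf f g = (THE h. h \<in> order_dual \<and> dual_le h f \<and> dual_le h g \<and>
     (\<forall>k\<in>order_dual. dual_le k f \<and> dual_le k g \<longrightarrow> dual_le k h))"

definition dual_abs :: "('v::banach_lattice \<Rightarrow> real) \<Rightarrow> 'v \<Rightarrow> real" where
  "dual_abs f = dual_sup f (\<lambda>x. - f x)"

definition directed_set :: "'i set \<Rightarrow> ('i \<Rightarrow> 'i \<Rightarrow> bool) \<Rightarrow> bool" where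
  "directed_set A le \<longleftrightarrow>
     A \<noteq> {} \<and> (\<forall>a\<in>A. le a a) \<and>
     (\<forall>a\<in>A. \<forall>b\<in>A. \<forall>c\<in>A. le a b \<longrightarrow> le b c \<longrightarrow> le a c) \<and>
     (\<forall>a\<in>A. \<forall>b\<in>A. \<exists>c\<in>A. le a c \<and> le b c)"

definition decreases_to_zero ::
  "'i set \<Rightarrow> ('i \<Rightarrow> 'i \<Rightarrow> bool) \<Rightarrow> ('i \<Rightarrow> 'v::banach_lattice) \<Rightarrow> bool" where
  "decreases_to_zero A le y \<longleftrightarrow>
     (\<forall>a\<in>A. \<forall>b\<in>A. le a b \<longrightarrow> y b \<le> y a) \<and>
     (\<forall>a\<in>A. 0 \<le> y a) \<and> (\<forall>z. (\<forall>a\<in>A. z \<le> y a) \<longrightarrow> z \<le> 0)"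

definition order_null ::
  "'i set \<Rightarrow> ('i \<Rightarrow> 'i \<Rightarrow> bool) \<Rightarrow> ('i \<Rightarrow> 'v::banach_lattice) \<Rightarrow> bool" where
  "order_null A le x \<longleftrightarrow> (\<exists>y. decreases_to_zero A le y \<and> (\<forall>a\<in>A. \<bar>x a\<bar> \<le> y a))"

text \<open>
  Nets indexed by directed sets in \<open>'v\<close> itself suffice. If \<open>\<bar>f (x a)\<bar> \<ge> \<epsilon>\<close> for cofinally many
  indices \<open>a\<close> of an arbitrary net \<open>x\<close> dominated by \<open>y\<close> decreasing to zero, then the values \<open>d = y a\<close>
  at these indices, ordered by \<open>\<ge>\<close>, form a directed set in \<open>'v\<close>, and choosing for each \<open>d\<close> one such
  \<open>x a\<close> with \<open>y a = d\<close> gives a net over it on which \<open>f\<close> fails as well.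
\<close>

definition order_continuous :: "('v::banach_lattice \<Rightarrow> real) \<Rightarrow> bool" where
  "order_continuous f \<longleftrightarrow>
     (\<forall>(A::'v set) le x. directed_set A le \<and> order_null A le x \<longrightarrow>
        (\<forall>\<epsilon>>0. \<exists>a\<in>A. \<forall>b\<in>A. le a b \<longrightarrow> \<bar>f (x b)\<bar> < \<epsilon>))"

definition order_cont_dual :: "('v::banach_lattice \<Rightarrow> real) set" where
  "order_cont_dual = {f \<in> order_dual. order_continuous f}"

definition singular_dual :: "('v::banach_lattice \<Rightarrow> real) set" where
  "singular_dual =
     {f \<in> order_dual. \<forall>g\<in>order_cont_dual. dual_inf (dual_abs f) (dual_abs g) = (\<lambda>x. 0)}"

section \<open>Dual elements and penalty\<close>

definition GG_cont_dual :: "('v::am_algebra \<Rightarrow> real) set" where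
  "GG_cont_dual = {l \<in> int_cone \<rightarrow>\<^sub>E {0<..}.
     (\<lambda>v. ln (l (am_exp v))) \<in> order_cont_dual \<and> pos_functional (\<lambda>v. ln (l (am_exp v)))}"

definition GG_sing_dual :: "('v::am_algebra \<Rightarrow> real) set" where
  "GG_sing_dual = {l \<in> int_cone \<rightarrow>\<^sub>E {0<..}.
     (\<lambda>v. ln (l (am_exp v))) \<in> singular_dual \<and> pos_functional (\<lambda>v. ln (l (am_exp v)))}"

definition GG_dual_set :: "('v::am_algebra \<Rightarrow> real) set" where
  "GG_dual_set = {(\<lambda>x\<in>int_cone. lc x * ls x) | lc ls.
     lc \<in> GG_cont_dual \<and> ls \<in> GG_sing_dual \<and>
     (SUP x\<in>{x. 1 \<le> x \<and> norm (am_log x) = 1}. ereal (lc x * ls x)) = ereal (exp 1)}"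

definition penalty :: "('v::am_algebra \<Rightarrow> ereal) \<Rightarrow> ('v \<Rightarrow> real) \<Rightarrow> ereal" where
  "penalty \<rho> l = (SUP x\<in>int_cone. ereal (l x) / \<rho> x)"

end

theory Submission
  imports Defs
begin

text \<open>
  In the logarithmic coordinates \<open>x = exp u\<close> a GG-convex return risk measure becomes a convex, monotone
  functional \<open>r\<close> on \<open>V\<close> with \<open>r (u + c e) = r u + c\<close>, and the elements of \<open>L\<close> become the positive
  linear functionals \<open>f\<close> with \<open>f e = 1\<close>: the supremum condition is attained at \<open>exp e\<close>, and every
  positive functional splits into an order continuous and a singular part. Being proper, \<open>r\<close> is
  finite and Lipschitz, so by Hahn--Banach it has a subgradient at every point; monotonicity and
  translation make it such an \<open>f\<close>, and the maximum is attained there. The functional calculus rests on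
  a representation of \<open>V\<close> as \<open>C(K)\<close>, with \<open>K\<close> the unital lattice homomorphisms to the reals; these
  are automatically multiplicative.
\<close>

section \<open>Dominated linear functionals\<close>

text \<open>The functional calculus refers to a representation picked by choice, so
  \<open>am_exp\<close> and \<open>am_power\<close> have no provable properties until some
  representation is shown to exist. This is why Stone--Weierstrass and the construction of
  characters precede any statement about risk. The subgradient delivered by Hahn--Banach comes with
  no order continuity; the singular factor in the elements of \<open>L\<close> absorbs what is lost,
  and only then is the maximum attained inside \<open>L\<close>. Attainment in turn makes the
  reverse implication elementary: at every point one affine functional touches \<open>r\<close> from
  below, and each property of \<open>\<rho>\<close> is read off from a single such
  functional.\<close>

definition sublinear :: "('a::real_vector \<Rightarrow> real) \<Rightarrow> bool" where
  "sublinear q \<longleftrightarrow> (\<forall>x y. q (x + y) \<le> q x + q y) \<and> (\<forall>c\<ge>0. \<forall>x. q (c *\<^sub>R x) = c * q x)"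

lemma sublinear_add: "sublinear q \<Longrightarrow> q (x + y) \<le> q x + q y"
  and sublinear_scale: "sublinear q \<Longrightarrow> 0 \<le> c \<Longrightarrow> q (c *\<^sub>R x) = c * q x"
  by (auto simp: sublinear_def)

lemma sublinear_0: "sublinear q \<Longrightarrow> q 0 = 0"
  using sublinear_scale[of q 0 0] by simp

lemma sublinear_ge_minus: "sublinear q \<Longrightarrow> - q (- x) \<le> q x"
  using sublinear_add[of q x "- x"] sublinear_0[of q] by simp

text \<open>A sublinear \<open>s\<close> below \<open>q\<close> with
  \<open>s (- y) \<le> - q y\<close> satisfies \<open>s x \<le> s (x + t *\<^sub>R y) + t * s (- y)
  \<le> q (x + t *\<^sub>R y) - t * q y\<close>. The infimum is therefore the largest such
  \<open>s\<close>.\<close>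

definition sublinear_shift :: "('a::real_vector \<Rightarrow> real) \<Rightarrow> 'a \<Rightarrow> 'a \<Rightarrow> real" where
  "sublinear_shift q y x = (INF t\<in>{0..}. q (x + t *\<^sub>R y) - t * q y)"

lemma sublinear_shift_bdd:
  assumes "sublinear q"
  shows "bdd_below ((\<lambda>t. q (x + t *\<^sub>R y) - t * q y) ` {0..})"
proof (rule bdd_belowI2[where m = "- q (- x)"])
  fix t :: real assume "t \<in> {0..}"
  then have "t * q y = q ((x + t *\<^sub>R y) + - x)"
    using assms by (simp add: sublinear_scale)
  also have "\<dots> \<le> q (x + t *\<^sub>R y) + q (- x)"
    using assms by (rule sublinear_add)
  finally show "- q (- x) \<le> q (x + t *\<^sub>R y) - t * q y" by simp
qed

lemma sublinear_shift_le:
  assumes "sublinear q" "0 \<le> t"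
  shows "sublinear_shift q y x \<le> q (x + t *\<^sub>R y) - t * q y"
  unfolding sublinear_shift_def using assms
  by (intro cINF_lower sublinear_shift_bdd) auto

text \<open>The functionals whose infimum defines the shift thus form a chain, so a property stable
  under infima of chains passes from \<open>q\<close> to its shift.\<close>

lemma sublinear_shift_antimono:
  assumes "sublinear q" "0 \<le> s" "s \<le> t"
  shows "q (x + t *\<^sub>R y) - t * q y \<le> q (x + s *\<^sub>R y) - s * q y"
proof -
  have "q (x + t *\<^sub>R y) = q ((x + s *\<^sub>R y) + (t - s) *\<^sub>R y)"
    by (simp add: algebra_simps)
  also have "\<dots> \<le> q (x + s *\<^sub>R y) + (t - s) * q y"
    using assms sublinear_add[of q "x + s *\<^sub>R y" "(t - s) *\<^sub>R y"] by (simp add: sublinear_scale)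
  finally show ?thesis by (simp add: algebra_simps)
qed

lemma sublinear_sublinear_shift:
  assumes q: "sublinear q"
  shows "sublinear (sublinear_shift q y)"
  unfolding sublinear_def
proof (intro conjI allI impI)
  fix x z
  have *: "sublinear_shift q y (x + z) \<le>
      (q (x + s *\<^sub>R y) - s * q y) + (q (z + t *\<^sub>R y) - t * q y)" if "0 \<le> s" "0 \<le> t" for s t
  proof -
    have "sublinear_shift q y (x + z) \<le> q ((x + s *\<^sub>R y) + (z + t *\<^sub>R y)) - (s + t) * q y"
      using sublinear_shift_le[OF q, of "s + t" y "x + z"] that by (simp add: algebra_simps)
    also have "\<dots> \<le> q (x + s *\<^sub>R y) + q (z + t *\<^sub>R y) - (s + t) * q y"
      using sublinear_add[OF q] by simp
    finally show ?thesis by (simp add: algebra_simps)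
  qed
  have "sublinear_shift q y (x + z) - (q (x + s *\<^sub>R y) - s * q y) \<le> sublinear_shift q y z"
    if "0 \<le> s" for s
    unfolding sublinear_shift_def[of q y z]
  proof (rule cINF_greatest)
    fix t :: real assume "t \<in> {0..}"
    with *[OF that, of t] show "sublinear_shift q y (x + z) - (q (x + s *\<^sub>R y) - s * q y)
        \<le> q (z + t *\<^sub>R y) - t * q y" by simp
  qed simp
  then have "sublinear_shift q y (x + z) - sublinear_shift q y z \<le> sublinear_shift q y x"
    unfolding sublinear_shift_def[of q y x]
    by (intro cINF_greatest) (auto simp: algebra_simps)
  then show "sublinear_shift q y (x + z) \<le> sublinear_shift q y x + sublinear_shift q y z"
    by simp
next
  fix c :: real and x assume "0 \<le> c"
  \<comment> \<open>Only one inequality is proved for positive factors; the reverse one is the same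
    inequality for \<open>inverse c\<close> at \<open>c *\<^sub>R x\<close>. The later homogeneity
    proofs use the same device.\<close>
  have le: "sublinear_shift q y (c *\<^sub>R x) \<le> c * sublinear_shift q y x" if c: "0 < c" for c x
  proof -
    have "sublinear_shift q y (c *\<^sub>R x) / c \<le> q (x + t *\<^sub>R y) - t * q y" if "0 \<le> t" for t
    proof -
      have "sublinear_shift q y (c *\<^sub>R x) \<le> q (c *\<^sub>R (x + t *\<^sub>R y)) - (c * t) * q y"
        using sublinear_shift_le[OF q, of "c * t" y "c *\<^sub>R x"] that c by (simp add: algebra_simps)
      also have "\<dots> = c * (q (x + t *\<^sub>R y) - t * q y)"
        using c q by (simp only: sublinear_scale less_imp_le) (simp add: algebra_simps)
      finally show ?thesis using c by (simp add: field_simps)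
    qed
    then have "sublinear_shift q y (c *\<^sub>R x) / c \<le> sublinear_shift q y x"
      unfolding sublinear_shift_def[of q y x] by (intro cINF_greatest) auto
    then show ?thesis using c by (simp add: field_simps)
  qed
  show "sublinear_shift q y (c *\<^sub>R x) = c * sublinear_shift q y x"
  proof (cases "c = 0")
    case True
    then show ?thesis using q by (simp add: sublinear_shift_def sublinear_scale)
  next
    case False
    with \<open>0 \<le> c\<close> have c: "0 < c" by simp
    have "c * sublinear_shift q y x \<le> sublinear_shift q y (c *\<^sub>R x)"
      using le[of "inverse c" "c *\<^sub>R x"] c by (simp add: field_simps)
    with le[OF c, of x] show ?thesis by simp
  qed
qed

text \<open>Infima of sublinear functionals are not subadditive in general. In a chain, two members
  \<open>f\<close> and \<open>g\<close> chosen for \<open>x\<close> and \<open>y\<close> separately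
  have a member below both, and its subadditivity suffices.\<close>

lemma sublinear_INF:
  assumes ne: "F \<noteq> {}" and sub: "\<And>f. f \<in> F \<Longrightarrow> sublinear f"
    and chain: "\<And>f g. f \<in> F \<Longrightarrow> g \<in> F \<Longrightarrow> f \<le> g \<or> g \<le> f"
    and bdd: "\<And>x. bdd_below ((\<lambda>f. f x) ` F)"
  shows "sublinear (\<lambda>x. INF f\<in>F. f x)"
  unfolding sublinear_def
proof (intro conjI allI impI)
  fix x y
  have *: "(INF f\<in>F. f (x + y)) \<le> f x + g y" if fg: "f \<in> F" "g \<in> F" for f g
  proof -
    obtain h where h: "h \<in> F" "h \<le> f" "h \<le> g" using chain[OF fg] fg by blast
    have "(INF f\<in>F. f (x + y)) \<le> h (x + y)" using bdd h(1) by (rule cINF_lower)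
    also have "\<dots> \<le> h x + h y" using sub[OF h(1)] by (rule sublinear_add)
    also have "\<dots> \<le> f x + g y" using h by (intro add_mono) (auto simp: le_fun_def)
    finally show ?thesis .
  qed
  have "(INF f\<in>F. f (x + y)) - f x \<le> (INF f\<in>F. f y)" if "f \<in> F" for f
    using ne *[OF that] by (intro cINF_greatest) (auto simp: algebra_simps)
  then have "(INF f\<in>F. f (x + y)) - (INF f\<in>F. f y) \<le> (INF f\<in>F. f x)"
    using ne by (intro cINF_greatest) (auto simp: algebra_simps)
  then show "(INF f\<in>F. f (x + y)) \<le> (INF f\<in>F. f x) + (INF f\<in>F. f y)" by simp
next
  fix c :: real and x assume c: "0 \<le> c"
  have "(INF f\<in>F. f (c *\<^sub>R x)) = (INF f\<in>F. c * f x)"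
    using sub c by (intro INF_cong) (auto simp: sublinear_scale)
  also have "\<dots> = c * (INF f\<in>F. f x)"
  proof (cases "c = 0")
    case True
    then show ?thesis using ne by simp
  next
    case False
    with c have c: "0 < c" by simp
    show ?thesis
    proof (rule antisym)
      have "(INF f\<in>F. c * f x) / c \<le> (INF f\<in>F. f x)"
      proof (intro cINF_greatest ne)
        fix f assume f: "f \<in> F"
        have "(INF f\<in>F. c * f x) \<le> c * f x"
        proof (rule cINF_lower[OF _ f])
          obtain m where "\<And>g. g \<in> F \<Longrightarrow> m \<le> g x" using bdd[of x] by (auto simp: bdd_below_def)
          then show "bdd_below ((\<lambda>f. c * f x) ` F)"
            using c by (intro bdd_belowI2[where m = "c * m"]) auto
        qed
        then show "(INF f\<in>F. c * f x) / c \<le> f x" using c by (simp add: field_simps)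
      qed
      then show "(INF f\<in>F. c * f x) \<le> c * (INF f\<in>F. f x)" using c by (simp add: field_simps)
      show "c * (INF f\<in>F. f x) \<le> (INF f\<in>F. c * f x)"
        using c by (intro cINF_greatest ne mult_left_mono cINF_lower bdd) auto
    qed
  qed
  finally show "(INF f\<in>F. f (c *\<^sub>R x)) = c * (INF f\<in>F. f x)" .
qed

text \<open>
  A minimal sublinear functional \<open>q\<close> agrees with all its shifts, and a shift in direction \<open>y\<close>
  has value at most \<open>- q y\<close> at \<open>- y\<close>; hence \<open>q\<close> is linear. The predicate \<open>P\<close> singles out a class
  of functionals in which the minimization can take place: with \<open>P\<close> trivial this is the
  Hahn--Banach theorem, with \<open>P\<close> = preservation of suprema it yields lattice homomorphisms.
\<close>

lemma linear_minorant:
  fixes p :: "'a::real_vector \<Rightarrow> real"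
  assumes p: "sublinear p" "P p"
    and P_INF: "\<And>F. F \<noteq> {} \<Longrightarrow> (\<And>f. f \<in> F \<Longrightarrow> P f) \<Longrightarrow>
      (\<And>f g. f \<in> F \<Longrightarrow> g \<in> F \<Longrightarrow> f \<le> g \<or> g \<le> f) \<Longrightarrow>
      (\<And>x. bdd_below ((\<lambda>f. f x) ` F)) \<Longrightarrow> P (\<lambda>x. INF f\<in>F. f x)"
    and P_translate: "\<And>q y c. P q \<Longrightarrow> P (\<lambda>x. q (x + y) - c)"
  obtains f where "linear f" "P f" "\<And>x. f x \<le> p x" "f y = p y"
proof -
  have P_shift: "P (sublinear_shift q y)" if "sublinear q" "P q" for q y
  proof -
    define F where "F = (\<lambda>t x. q (x + t *\<^sub>R y) - t * q y) ` {0..}"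
    have "P (\<lambda>x. INF f\<in>F. f x)"
    proof (rule P_INF)
      show "F \<noteq> {}" by (simp add: F_def)
      show "P f" if "f \<in> F" for f using that \<open>P q\<close> P_translate by (auto simp: F_def)
      show "f \<le> g \<or> g \<le> f" if fg: "f \<in> F" "g \<in> F" for f g
      proof -
        obtain s t where "0 \<le> s" "0 \<le> t"
          "f = (\<lambda>x. q (x + s *\<^sub>R y) - s * q y)" "g = (\<lambda>x. q (x + t *\<^sub>R y) - t * q y)"
          using fg by (auto simp: F_def)
        then show ?thesis
          using sublinear_shift_antimono[OF \<open>sublinear q\<close>] linear[of s t]
          by (auto simp: le_fun_def)
      qed
      show "bdd_below ((\<lambda>f. f x) ` F)" for x
        using sublinear_shift_bdd[OF \<open>sublinear q\<close>, of x y] by (simp add: F_def image_image)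
    qed
    then show ?thesis
      by (simp add: F_def image_image sublinear_shift_def[abs_def])
  qed
  \<comment> \<open>Minimizing below this shift instead of below \<open>p\<close> forces
    \<open>m (- y) \<le> - p y\<close>, which for linear \<open>m\<close> gives
    \<open>p y \<le> m y\<close>.\<close>
  define q0 where "q0 = sublinear_shift p y"
  have q0: "sublinear q0" "P q0"
    using p P_shift by (auto simp: q0_def sublinear_sublinear_shift)
  define A where "A = {q. sublinear q \<and> P q \<and> q \<le> q0}"
  have "\<exists>m\<in>A. \<forall>a\<in>A. m \<ge> a \<longrightarrow> a = m"
  proof (rule predicate_Zorn)
    show "partial_order_on A (relation_of (\<ge>) A)"
      by (rule partial_order_on_relation_ofI) auto
    fix C assume C: "C \<in> Chains (relation_of (\<ge>) A)"
    show "\<exists>u\<in>A. \<forall>a\<in>C. a \<ge> u"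
    proof (cases "C = {}")
      case True
      then show ?thesis using q0 by (auto simp: A_def)
    next
      case False
      have CA: "C \<subseteq> A" and chain: "\<And>f g. f \<in> C \<Longrightarrow> g \<in> C \<Longrightarrow> f \<le> g \<or> g \<le> f"
        using C by (auto simp: Chains_def relation_of_def)
      have bdd: "bdd_below ((\<lambda>f. f x) ` C)" for x
      proof (rule bdd_belowI2[where m = "- q0 (- x)"])
        fix f assume "f \<in> C"
        then have "sublinear f" "f (- x) \<le> q0 (- x)" using CA by (auto simp: A_def le_fun_def)
        then show "- q0 (- x) \<le> f x" using sublinear_ge_minus[of f x] by simp
      qed
      have lower: "(INF f\<in>C. f x) \<le> f x" if "f \<in> C" for f x
        using bdd that by (rule cINF_lower)
      obtain f where "f \<in> C" using False by blast
      have "(\<lambda>x. INF f\<in>C. f x) \<in> A"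
        unfolding A_def mem_Collect_eq
      proof (intro conjI)
        show "sublinear (\<lambda>x. INF f\<in>C. f x)"
          using False chain bdd CA by (intro sublinear_INF) (auto simp: A_def)
        show "P (\<lambda>x. INF f\<in>C. f x)"
          using False chain bdd CA by (intro P_INF) (auto simp: A_def)
        show "(\<lambda>x. INF f\<in>C. f x) \<le> q0"
          using lower[OF \<open>f \<in> C\<close>] \<open>f \<in> C\<close> CA by (force simp: A_def le_fun_def intro: order_trans)
      qed
      then show ?thesis using lower by (intro bexI) (auto simp: le_fun_def)
    qed
  qed
  then obtain m where m: "m \<in> A" and min: "\<And>a. a \<in> A \<Longrightarrow> a \<le> m \<Longrightarrow> a = m" by blast
  have sub: "sublinear m" and "P m" and mq0: "m \<le> q0" using m by (auto simp: A_def)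
  have minus: "m (- z) = - m z" for z
  proof -
    have le: "sublinear_shift m z \<le> m"
      using sublinear_shift_le[OF sub, of 0 z] by (auto simp: le_fun_def)
    have "sublinear_shift m z \<in> A"
      using order_trans[OF le mq0] sub \<open>P m\<close> P_shift by (auto simp: A_def sublinear_sublinear_shift)
    then have "sublinear_shift m z = m" using le by (rule min)
    then have "m (- z) \<le> - m z"
      using sublinear_shift_le[OF sub, of 1 z "- z"] sublinear_0[OF sub] by simp
    then show ?thesis using sublinear_ge_minus[OF sub, of z] by simp
  qed
  have "linear m"
  proof (rule linearI)
    fix x z
    have "m x + m z \<le> m (x + z)"
      using sublinear_add[OF sub, of "- x" "- z"] minus[of x] minus[of z] minus[of "x + z"]
      by simp
    then show "m (x + z) = m x + m z" using sublinear_add[OF sub, of x z] by simp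
  next
    fix c x
    show "m (c *\<^sub>R x) = c *\<^sub>R m x"
    proof (cases "0 \<le> c")
      case True
      then show ?thesis using sub by (simp add: sublinear_scale)
    next
      case False
      then have "m ((- c) *\<^sub>R x) = (- c) * m x" using sub by (intro sublinear_scale) auto
      then show ?thesis using minus[of "c *\<^sub>R x"] by simp
    qed
  qed
  moreover have q0p: "q0 x \<le> p x" for x
    using sublinear_shift_le[OF p(1), of 0 y x] by (simp add: q0_def)
  have "m x \<le> p x" for x using mq0 q0p[of x] by (auto simp: le_fun_def intro: order_trans)
  moreover have "m y = p y"
  proof (rule antisym)
    have "m (- y) \<le> q0 (- y)" using mq0 by (simp add: le_fun_def)
    also have "\<dots> \<le> - p y"
      using sublinear_shift_le[OF p(1), of 1 y "- y"] sublinear_0[OF p(1)] by (simp add: q0_def)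
    finally show "p y \<le> m y" by (simp add: minus)
  qed fact
  ultimately show thesis using that \<open>P m\<close> by blast
qed

theorem hahn_banach:
  fixes p :: "'a::real_vector \<Rightarrow> real"
  assumes "sublinear p"
  obtains f where "linear f" "\<And>x. f x \<le> p x" "f y = p y"
  by (rule linear_minorant[of p "\<lambda>_. True" y]) (auto simp: assms)

text \<open>Translation commutes with \<open>sup\<close>, and subtracting a constant commutes with
  \<open>max\<close>, so the property survives the terms of a shift. For the infimum of a chain,
  members that are small at \<open>x\<close> and at \<open>z\<close> separately can be replaced by
  the smaller of the two, which is small at both.\<close>

lemma sup_preserving_minorant:
  fixes p :: "'a::{real_vector, lattice_ab_group_add} \<Rightarrow> real"
  assumes "sublinear p" "\<And>x z. p (sup x z) = max (p x) (p z)"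
  obtains f where "linear f" "\<And>x z. f (sup x z) = max (f x) (f z)" "\<And>x. f x \<le> p x" "f y = p y"
proof (rule linear_minorant[of p "\<lambda>f. \<forall>x z. f (sup x z) = max (f x) (f z)" y])
  fix F :: "('a \<Rightarrow> real) set"
  assume ne: "F \<noteq> {}" and sup: "\<And>f. f \<in> F \<Longrightarrow> \<forall>x z. f (sup x z) = max (f x) (f z)"
    and chain: "\<And>f g. f \<in> F \<Longrightarrow> g \<in> F \<Longrightarrow> f \<le> g \<or> g \<le> f"
    and bdd: "\<And>x. bdd_below ((\<lambda>f. f x) ` F)"
  have lower: "(INF f\<in>F. f x) \<le> f x" if "f \<in> F" for f x
    using bdd that by (rule cINF_lower)
  show "\<forall>x z. (INF f\<in>F. f (sup x z)) = max (INF f\<in>F. f x) (INF f\<in>F. f z)"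
  proof (intro allI antisym)
    fix x z
    show "max (INF f\<in>F. f x) (INF f\<in>F. f z) \<le> (INF f\<in>F. f (sup x z))"
    proof (rule cINF_greatest[OF ne])
      fix f assume "f \<in> F"
      then show "max (INF f\<in>F. f x) (INF f\<in>F. f z) \<le> f (sup x z)"
        using lower[of f x] lower[of f z] sup[of f] by (auto intro: le_max_iff_disj[THEN iffD2])
    qed
    show "(INF f\<in>F. f (sup x z)) \<le> max (INF f\<in>F. f x) (INF f\<in>F. f z)"
    proof (rule ccontr)
      assume "\<not> ?thesis"
      then have lt: "(INF f\<in>F. f x) < (INF f\<in>F. f (sup x z))"
        "(INF f\<in>F. f z) < (INF f\<in>F. f (sup x z))" by auto
      obtain f where f: "f \<in> F" "f x < (INF f\<in>F. f (sup x z))"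
        using lt(1) ne bdd by (auto simp: cINF_less_iff)
      obtain g where g: "g \<in> F" "g z < (INF f\<in>F. f (sup x z))"
        using lt(2) ne bdd by (auto simp: cINF_less_iff)
      obtain h where h: "h \<in> F" "h \<le> f" "h \<le> g" using chain[OF f(1) g(1)] f(1) g(1) by blast
      have "h x < (INF f\<in>F. f (sup x z))" "h z < (INF f\<in>F. f (sup x z))"
        using f(2) g(2) h(2,3) by (auto simp: le_fun_def intro: le_less_trans)
      then have "h (sup x z) < (INF f\<in>F. f (sup x z))" using sup[OF h(1)] by simp
      with lower[OF h(1), of "sup x z"] show False by simp
    qed
  qed
qed (use assms that in \<open>auto simp: add_sup_distrib_right\<close>)

section \<open>The representation of an AM-algebra on its lattice homomorphisms\<close>

lemma nonneg_decomposition: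
  fixes x :: "'v::lattice_ab_group_add"
  obtains u v where "0 \<le> u" "0 \<le> v" "x = u - v"
  by (rule that[of "pprt x" "- nprt x"]) (use prts[of x] in simp_all)

section \<open>The order unit norm\<close>

lemma scaleR_one_le_iff [simp]: "a *\<^sub>R (1::'v::am_algebra) \<le> b *\<^sub>R 1 \<longleftrightarrow> a \<le> b"
proof
  show "a *\<^sub>R (1::'v) \<le> b *\<^sub>R 1" if "a \<le> b"
    using that unit_pos[where 'a = 'v] by (intro scaleR_right_mono) auto
  assume *: "a *\<^sub>R (1::'v) \<le> b *\<^sub>R 1"
  show "a \<le> b"
  proof (rule ccontr)
    assume "\<not> a \<le> b"
    then have "0 < inverse (a - b)" "(a - b) *\<^sub>R (1::'v) \<le> 0"
      using * by (auto simp: algebra_simps)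
    then have "inverse (a - b) *\<^sub>R ((a - b) *\<^sub>R (1::'v)) \<le> inverse (a - b) *\<^sub>R 0"
      by (intro scaleR_left_mono) auto
    then have "(1::'v) \<le> 0" using \<open>\<not> a \<le> b\<close> by simp
    then show False using unit_pos[where 'a = 'v] by simp
  qed
qed

text \<open>The Archimedean property along the unit. It rests on definiteness of the norm: the
  positive part of \<open>x\<close> has norm at most every \<open>e > 0\<close> and hence
  vanishes.\<close>

lemma le_zero_if_le_scaleR_one:
  fixes x :: "'v::am_algebra"
  assumes "\<And>e. 0 < e \<Longrightarrow> x \<le> e *\<^sub>R 1"
  shows "x \<le> 0"
proof -
  have "norm (pprt x) \<le> e" if e: "0 < e" for e
  proof -
    have "pprt x \<le> pprt (e *\<^sub>R 1)" using assms e by (intro pprt_mono) auto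
    also have "\<dots> = e *\<^sub>R 1" using e scaleR_one_le_iff[of 0 e] by (intro pprt_eq_id) simp
    finally have "\<bar>pprt x\<bar> \<le> e *\<^sub>R 1" by simp
    with e show ?thesis
      unfolding norm_order_unit by (intro cInf_lower bdd_belowI[where m = 0]) auto
  qed
  then have "norm (pprt x) \<le> 0" by (rule field_le_epsilon) (simp only: add_0_left)
  then have "pprt x = 0" by simp
  then show ?thesis by (simp only: le_zero_iff_zero_pprt)
qed

text \<open>By the Archimedean property the infimum in \<open>norm_order_unit\<close> is
  attained.\<close>

lemma abs_le_norm: "\<bar>x\<bar> \<le> norm x *\<^sub>R (1::'v::am_algebra)"
proof -
  have "\<bar>x\<bar> - norm x *\<^sub>R 1 \<le> e *\<^sub>R 1" if e: "0 < e" for e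
  proof -
    have "Inf {c. 0 < c \<and> \<bar>x\<bar> \<le> c *\<^sub>R 1} < norm x + e"
      unfolding norm_order_unit[symmetric] using e by simp
    then obtain c where c: "\<bar>x\<bar> \<le> c *\<^sub>R 1" "c < norm x + e"
      using order_unit[of x] by (subst (asm) cInf_less_iff) (auto intro: bdd_belowI[where m = 0])
    have "c *\<^sub>R 1 \<le> (norm x + e) *\<^sub>R (1::'v)" unfolding scaleR_one_le_iff using c by simp
    with c(1) have "\<bar>x\<bar> \<le> (norm x + e) *\<^sub>R 1" by (rule order_trans)
    then show ?thesis by (simp only: scaleR_add_left diff_le_eq add.commute)
  qed
  then have "\<bar>x\<bar> - norm x *\<^sub>R 1 \<le> 0" by (rule le_zero_if_le_scaleR_one)
  then show ?thesis by (simp only: diff_le_0_iff_le)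
qed

lemma le_norm: "x \<le> norm x *\<^sub>R (1::'v::am_algebra)"
  using abs_ge_self abs_le_norm by (rule order_trans)

lemma minus_norm_le: "- norm x *\<^sub>R (1::'v::am_algebra) \<le> x"
  using order_trans[OF abs_ge_minus_self abs_le_norm, of x] by (simp add: minus_le_iff)

lemma norm_le_iff_abs_le: "norm x \<le> c \<longleftrightarrow> \<bar>x\<bar> \<le> c *\<^sub>R (1::'v::am_algebra)"
proof
  assume "norm x \<le> c"
  then have "norm x *\<^sub>R 1 \<le> c *\<^sub>R (1::'v)" by simp
  with abs_le_norm show "\<bar>x\<bar> \<le> c *\<^sub>R 1" by (rule order_trans)
next
  assume *: "\<bar>x\<bar> \<le> c *\<^sub>R 1"
  with abs_ge_zero have "0 *\<^sub>R 1 \<le> c *\<^sub>R (1::'v)" unfolding scaleR_zero_left by (rule order_trans)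
  then consider "c = 0" | "0 < c" unfolding scaleR_one_le_iff by linarith
  then show "norm x \<le> c"
  proof cases
    case 1
    then show ?thesis using * by simp
  next
    case 2
    then show ?thesis using *
      unfolding norm_order_unit by (intro cInf_lower bdd_belowI[where m = 0]) auto
  qed
qed

text \<open>In \<open>C(K)\<close> this is the maximum of the function over \<open>K\<close>. Unlike
  the norm it preserves suprema of arbitrary elements, which makes it the starting point for
  constructing characters.\<close>

definition upper_value :: "'v::am_algebra \<Rightarrow> real" where
  "upper_value x = Inf {c. x \<le> c *\<^sub>R 1}"

text \<open>The infimum is again attained by the Archimedean property. In this form
  \<open>upper_value\<close> is the lower adjoint of \<open>c \<mapsto> c *\<^sub>R 1\<close>, and
  its values are computed by comparing upper bounds.\<close>

lemma upper_value_le_iff: "upper_value x \<le> c \<longleftrightarrow> x \<le> c *\<^sub>R 1"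
proof -
  have bdd: "bdd_below {c. x \<le> c *\<^sub>R 1}"
  proof (rule bdd_belowI[where m = "- norm x"])
    fix c assume "c \<in> {c. x \<le> c *\<^sub>R 1}"
    then have "(- norm x) *\<^sub>R 1 \<le> c *\<^sub>R (1::'a)"
      using minus_norm_le[of x] by (auto intro: order_trans)
    then show "- norm x \<le> c" unfolding scaleR_one_le_iff .
  qed
  have "x - upper_value x *\<^sub>R 1 \<le> e *\<^sub>R 1" if e: "0 < e" for e
  proof -
    have "upper_value x < upper_value x + e" using e by simp
    then obtain d where d: "x \<le> d *\<^sub>R 1" "d < upper_value x + e"
      using le_norm[of x] bdd unfolding upper_value_def
      by (subst (asm) cInf_less_iff) (auto simp: upper_value_def)
    have "d *\<^sub>R 1 \<le> (upper_value x + e) *\<^sub>R (1::'a)" unfolding scaleR_one_le_iff using d by simp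
    with d(1) have "x \<le> (upper_value x + e) *\<^sub>R 1" by (rule order_trans)
    then show ?thesis by (simp only: scaleR_add_left diff_le_eq add.commute)
  qed
  then have "x - upper_value x *\<^sub>R 1 \<le> 0" by (rule le_zero_if_le_scaleR_one)
  then have attained: "x \<le> upper_value x *\<^sub>R 1" by (simp only: diff_le_0_iff_le)
  show ?thesis
  proof
    assume "upper_value x \<le> c"
    then have "upper_value x *\<^sub>R 1 \<le> c *\<^sub>R (1::'a)" by simp
    with attained show "x \<le> c *\<^sub>R 1" by (rule order_trans)
  next
    assume "x \<le> c *\<^sub>R 1"
    then show "upper_value x \<le> c" unfolding upper_value_def using bdd by (intro cInf_lower) auto
  qed
qed

lemma le_upper_value: "x \<le> upper_value x *\<^sub>R 1"
  using upper_value_le_iff[of x "upper_value x"] by simp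

lemma upper_value_scaleR_one [simp]: "upper_value (c *\<^sub>R (1::'v::am_algebra)) = c"
proof -
  have "upper_value (c *\<^sub>R (1::'v)) \<le> d \<longleftrightarrow> c \<le> d" for d
    by (simp add: upper_value_le_iff)
  then show ?thesis by (meson antisym order_refl)
qed

lemma upper_value_sup: "upper_value (sup x y) = max (upper_value x) (upper_value y)"
proof -
  have "upper_value (sup x y) \<le> c \<longleftrightarrow> max (upper_value x) (upper_value y) \<le> c" for c
    by (simp add: upper_value_le_iff)
  then show ?thesis by (meson antisym order_refl)
qed

lemma sublinear_upper_value: "sublinear (upper_value :: 'v::am_algebra \<Rightarrow> real)"
  unfolding sublinear_def
proof (intro conjI allI impI)
  fix x y :: 'v
  show "upper_value (x + y) \<le> upper_value x + upper_value y"
    unfolding upper_value_le_iff scaleR_add_left by (intro add_mono le_upper_value)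
next
  have le: "upper_value (c *\<^sub>R x) \<le> c * upper_value x" if "0 \<le> c" for c and x :: 'v
    using scaleR_left_mono[OF le_upper_value that] by (simp add: upper_value_le_iff)
  fix c :: real and x :: 'v assume "0 \<le> c"
  show "upper_value (c *\<^sub>R x) = c * upper_value x"
  proof (cases "c = 0")
    case True
    then show ?thesis using upper_value_scaleR_one[of 0, where 'v = 'v] by simp
  next
    case False
    then show ?thesis
      using le[of c x] le[of "inverse c" "c *\<^sub>R x"] \<open>0 \<le> c\<close> by (auto simp: field_simps)
  qed
qed

lemma upper_value_abs: "upper_value \<bar>x\<bar> = norm x"
proof -
  have "upper_value \<bar>x\<bar> \<le> c \<longleftrightarrow> norm x \<le> c" for c
    by (simp add: upper_value_le_iff norm_le_iff_abs_le)
  then show ?thesis by (meson antisym order_refl)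
qed

section \<open>Unital lattice homomorphisms\<close>

definition lattice_characters :: "('v::am_algebra \<Rightarrow> real) set" where
  "lattice_characters = {k. linear k \<and> (\<forall>x y. k (sup x y) = max (k x) (k y)) \<and> k 1 = 1}"

lemma lattice_characterD:
  assumes "k \<in> lattice_characters"
  shows "linear k" "k (sup x y) = max (k x) (k y)" "k 1 = 1" "k (x + y) = k x + k y"
    "k (x - y) = k x - k y" "k (c *\<^sub>R x) = c * k x" "k (- x) = - k x" "k 0 = 0"
  using assms
  by (auto simp: lattice_characters_def linear_add linear_diff linear_scale linear_neg linear_0)

lemma lattice_character_inf:
  assumes "k \<in> lattice_characters"
  shows "k (inf x y) = min (k x) (k y)"
  unfolding inf_eq_neg_sup[of x y] lattice_characterD[OF assms] by (simp add: min_def max_def)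

lemma lattice_character_abs:
  assumes "k \<in> lattice_characters"
  shows "k \<bar>x\<bar> = \<bar>k x\<bar>"
  by (simp add: abs_lattice[of x] lattice_characterD[OF assms] max_def abs_if)

lemma lattice_character_mono:
  assumes "k \<in> lattice_characters" "x \<le> y"
  shows "k x \<le> k y"
  using lattice_characterD(2)[OF assms(1), of x y] assms(2) by (simp add: sup_absorb2)

lemma abs_lattice_character_le_norm:
  assumes "k \<in> lattice_characters"
  shows "\<bar>k x\<bar> \<le> norm x"
  using lattice_character_mono[OF assms abs_le_norm[of x]]
  by (simp add: lattice_character_abs[OF assms] lattice_characterD[OF assms])

text \<open>
  For fixed \<open>x \<ge> 0\<close> the functional \<open>y \<mapsto> k (x * y)\<close> is dominated by a multiple of \<open>k\<close>, hence vanishes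
  on the kernel of \<open>k\<close>, which contains \<open>y - k y\<close>.
\<close>

lemma lattice_character_mult:
  assumes k: "k \<in> lattice_characters"
  shows "k (x * y) = k x * k y"
proof -
  note D = lattice_characterD[OF k]
  have pos: "k (x * y) = k x * k y" if x: "0 \<le> x" for x
  proof -
    define z where "z = y - k y *\<^sub>R 1"
    have "k \<bar>z\<bar> = 0" by (simp add: lattice_character_abs[OF k] z_def D)
    have "\<bar>x * z\<bar> \<le> \<bar>x\<bar> * \<bar>z\<bar>" by (rule abs_le_mult)
    also have "\<dots> \<le> (norm x *\<^sub>R 1) * \<bar>z\<bar>" by (intro mult_right_mono abs_le_norm abs_ge_zero)
    finally have "\<bar>x * z\<bar> \<le> norm x *\<^sub>R \<bar>z\<bar>" by simp
    from lattice_character_mono[OF k this] have "\<bar>k (x * z)\<bar> \<le> norm x * k \<bar>z\<bar>"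
      by (simp only: lattice_character_abs[OF k] D)
    then have "k (x * z) = 0" by (simp add: \<open>k \<bar>z\<bar> = 0\<close>)
    moreover have "x * z = x * y - k y *\<^sub>R x" by (simp add: z_def algebra_simps)
    ultimately show ?thesis by (simp only: D) simp
  qed
  obtain u v where uv: "0 \<le> u" "0 \<le> v" "x = u - v" by (rule nonneg_decomposition[of x])
  show ?thesis
    unfolding uv(3) left_diff_distrib D by (simp only: pos uv left_diff_distrib)
qed

text \<open>Domination by \<open>upper_value\<close> at \<open>1\<close> and at \<open>- 1\<close>
  forces \<open>k 1 = 1\<close>, and prescribing equality at \<open>\<bar>x\<bar>\<close> makes
  \<open>k\<close> norming, since \<open>upper_value\<close> of a modulus is the norm.\<close>

lemma lattice_character_norming:
  fixes x :: "'v::am_algebra"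
  obtains k where "k \<in> lattice_characters" "\<bar>k x\<bar> = norm x"
proof -
  obtain k :: "'v \<Rightarrow> real" where k: "linear k" "\<And>x z. k (sup x z) = max (k x) (k z)"
    "\<And>x. k x \<le> upper_value x" "k \<bar>x\<bar> = upper_value \<bar>x\<bar>"
    using sup_preserving_minorant[OF sublinear_upper_value upper_value_sup] by blast
  have "k 1 \<le> 1" using k(3)[of 1] upper_value_scaleR_one[of 1, where 'v = 'v] by simp
  moreover have "1 \<le> k 1"
    using k(3)[of "- 1"] upper_value_scaleR_one[of "- 1", where 'v = 'v] by (simp add: linear_neg[OF k(1)])
  ultimately have "k \<in> lattice_characters" using k by (simp add: lattice_characters_def)
  moreover from this have "\<bar>k x\<bar> = norm x"
    using k(4) by (simp add: lattice_character_abs upper_value_abs)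
  ultimately show thesis by (rule that)
qed

lemma norm_le_if_lattice_characters:
  fixes x :: "'v::am_algebra"
  assumes "\<And>k. k \<in> lattice_characters \<Longrightarrow> \<bar>k x\<bar> \<le> c"
  shows "norm x \<le> c"
  using lattice_character_norming[of x] assms by metis

text \<open>The Banach--Alaoglu argument: all defining conditions are equations between coordinates,
  hence closed in the product topology, and the values at \<open>x\<close> stay in
  \<open>[- norm x, norm x]\<close>, so Tychonoff applies.\<close>

lemma compact_lattice_characters: "compact (lattice_characters :: ('v::am_algebra \<Rightarrow> real) set)"
proof -
  let ?B = "PiE UNIV (\<lambda>x::'v. {- norm x..norm x})"
  have "compactin (product_topology (\<lambda>_::'v. euclideanreal) UNIV) ?B"
    by (auto simp: compactin_PiE)
  then have "compact ?B" by (simp add: euclidean_product_topology)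
  moreover have "closed (lattice_characters :: ('v \<Rightarrow> real) set)"
    unfolding lattice_characters_def linear_iff
    by (intro closed_Collect_conj closed_Collect_all closed_Collect_eq continuous_intros) auto
  moreover have "lattice_characters \<subseteq> ?B"
  proof
    fix k :: "'v \<Rightarrow> real" assume "k \<in> lattice_characters"
    then have "\<bar>k x\<bar> \<le> norm x" for x by (rule abs_lattice_character_le_norm)
    then show "k \<in> ?B" by (auto simp: abs_le_iff minus_le_iff)
  qed
  ultimately show ?thesis by (metis compact_Int_closed inf.absorb2)
qed

text \<open>
  The library's Stone--Weierstrass theorem asks for a Hausdorff type, which the function type
  over an arbitrary index type is not an instance of; hence this copy of the character space.
\<close>

typedef (overloaded) 'v lattice_character = "lattice_characters :: ('v::am_algebra \<Rightarrow> real) set"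
  using lattice_character_norming by blast

instantiation lattice_character :: (am_algebra) t2_space
begin

definition open_lattice_character :: "'a lattice_character set \<Rightarrow> bool" where
  "open_lattice_character U \<longleftrightarrow> (\<exists>V. open V \<and> U = Rep_lattice_character -` V)"

instance
proof
  show "open (UNIV :: 'a lattice_character set)"
    by (auto simp: open_lattice_character_def intro!: exI[of _ UNIV])
next
  fix U V :: "'a lattice_character set" assume "open U" "open V"
  then show "open (U \<inter> V)"
    unfolding open_lattice_character_def by (metis open_Int vimage_Int)
next
  fix \<U> :: "'a lattice_character set set" assume \<U>: "\<forall>U\<in>\<U>. open U"
  define V where "V = \<Union>{V. open V \<and> Rep_lattice_character -` V \<in> \<U>}"
  have "open V" unfolding V_def by auto
  moreover have "\<Union>\<U> = Rep_lattice_character -` V"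
  proof (intro equalityI subsetI)
    fix a assume "a \<in> \<Union>\<U>"
    then obtain U where U: "a \<in> U" "U \<in> \<U>" by blast
    then obtain W where "open W" "U = Rep_lattice_character -` W"
      using \<U> by (auto simp: open_lattice_character_def)
    then show "a \<in> Rep_lattice_character -` V" using U by (auto simp: V_def)
  qed (auto simp: V_def)
  ultimately show "open (\<Union>\<U>)" unfolding open_lattice_character_def by blast
next
  fix a b :: "'a lattice_character" assume "a \<noteq> b"
  then obtain x where "Rep_lattice_character a x \<noteq> Rep_lattice_character b x"
    by (metis Rep_lattice_character_inject ext)
  from hausdorff[OF this] obtain U V where UV: "open U" "open V" "Rep_lattice_character a x \<in> U"
    "Rep_lattice_character b x \<in> V" "U \<inter> V = {}"
    by blast
  have "open {h :: 'a \<Rightarrow> real. h x \<in> W}" if "open W" for W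
    using product_topology_basis'[of "{x}" "\<lambda>_. W" "\<lambda>i. i"] that by simp
  with UV show "\<exists>U V. open U \<and> open V \<and> a \<in> U \<and> b \<in> V \<and> U \<inter> V = {}"
    unfolding open_lattice_character_def
    by (intro exI[of _ "Rep_lattice_character -` {h. h x \<in> U}"]
        exI[of _ "Rep_lattice_character -` {h. h x \<in> V}"]) auto
qed

end

section \<open>Evaluation maps onto the continuous functions\<close>

lemma continuous_Rep_lattice_character: "continuous_on UNIV Rep_lattice_character"
  unfolding continuous_on_open_vimage[OF open_UNIV] open_lattice_character_def by auto

lemma compact_UNIV_lattice_character: "compact (UNIV :: 'v::am_algebra lattice_character set)"
proof -
  have "continuous_on lattice_characters (Abs_lattice_character :: _ \<Rightarrow> 'v lattice_character)"
    unfolding continuous_on_open_invariant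
  proof (intro allI impI)
    fix B :: "'v lattice_character set" assume "open B"
    then obtain V where "open V" "B = Rep_lattice_character -` V"
      by (auto simp: open_lattice_character_def)
    then show "\<exists>A. open A \<and> A \<inter> lattice_characters = Abs_lattice_character -` B \<inter> lattice_characters"
      by (intro exI[of _ V]) (auto simp: Abs_lattice_character_inverse)
  qed
  from compact_continuous_image[OF this compact_lattice_characters]
  show ?thesis
    using type_definition.Abs_image[OF type_definition_lattice_character] by metis
qed

text \<open>Stone--Weierstrass for the evaluations \<open>k \<mapsto> k x\<close>. They are closed
  under products because characters are multiplicative, contain the constants through multiples of
  \<open>1\<close>, and separate points because distinct characters differ at some
  \<open>x\<close>.\<close>

lemma lattice_characters_approx:
  fixes g :: "('v::am_algebra \<Rightarrow> real) \<Rightarrow> real"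
  assumes "continuous_on lattice_characters g" "0 < e"
  obtains x where "\<And>k. k \<in> lattice_characters \<Longrightarrow> \<bar>g k - k x\<bar> < e"
proof -
  define R where "R = range (\<lambda>x a. Rep_lattice_character a (x::'v))"
  note char = Rep_lattice_character
  interpret function_ring_on R UNIV
  proof
    show "continuous_on UNIV f" if "f \<in> R" for f
      using that continuous_on_product_then_coordinatewise[OF continuous_Rep_lattice_character]
      by (auto simp: R_def)
    show "(\<lambda>a. f a + h a) \<in> R" if "f \<in> R" "h \<in> R" for f h
      using that unfolding R_def by (auto simp flip: lattice_characterD(4)[OF char])
    show "(\<lambda>a. f a * h a) \<in> R" if "f \<in> R" "h \<in> R" for f h
      using that unfolding R_def by (auto simp flip: lattice_character_mult[OF char])
    show "(\<lambda>_. c) \<in> R" for c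
      unfolding R_def by (rule range_eqI[of _ _ "c *\<^sub>R 1"]) (simp add: lattice_characterD[OF char])
    show "\<exists>f\<in>R. f a \<noteq> f b" if ab: "a \<noteq> b" for a b
    proof -
      obtain x where "Rep_lattice_character a x \<noteq> Rep_lattice_character b x"
        using ab by (metis Rep_lattice_character_inject ext)
      then show ?thesis
        by (intro bexI[of _ "\<lambda>a. Rep_lattice_character a x"]) (auto simp: R_def)
    qed
  qed (rule compact_UNIV_lattice_character)
  have "continuous_on UNIV (\<lambda>a. g (Rep_lattice_character a))"
    using continuous_on_compose2[OF assms(1) continuous_Rep_lattice_character] char by auto
  from Stone_Weierstrass_basic[OF this assms(2)]
  obtain x where x: "\<And>a. \<bar>g (Rep_lattice_character a) - Rep_lattice_character a x\<bar> < e"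
    by (auto simp: R_def)
  show thesis by (rule that[of x]) (metis x Abs_lattice_character_inverse)
qed

text \<open>Completeness of \<open>V\<close> turns uniform approximation into equality: the norm is
  a supremum over characters, so uniformly convergent evaluations come from a Cauchy sequence in
  \<open>V\<close>.\<close>

lemma lattice_characters_surj:
  fixes g :: "('v::am_algebra \<Rightarrow> real) \<Rightarrow> real"
  assumes g: "continuous_on lattice_characters g"
  obtains x where "\<And>k. k \<in> lattice_characters \<Longrightarrow> g k = k x"
proof -
  have "\<exists>x. \<forall>k\<in>lattice_characters. \<bar>g k - k x\<bar> < 1 / real (Suc n)" for n
    using lattice_characters_approx[OF g, of "1 / real (Suc n)"] by (metis of_nat_0_less_iff zero_less_Suc zero_less_divide_1_iff)
  then obtain x :: "nat \<Rightarrow> 'v" where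
    x: "\<And>n k. k \<in> lattice_characters \<Longrightarrow> \<bar>g k - k (x n)\<bar> < 1 / real (Suc n)" by metis
  have "Cauchy x"
  proof (rule metric_CauchyI)
    fix e :: real assume "0 < e"
    \<comment> \<open>Passing from characters to the norm only gives a non-strict bound; two errors
      below \<open>e / 3\<close> leave \<open>2 * (e / 3)\<close>, which is still strictly below
      \<open>e\<close>.\<close>
    then obtain N where N: "1 / real (Suc N) < e / 3" using nat_approx_posE[of "e / 3"] by auto
    have "dist (x m) (x n) < e" if mn: "N \<le> m" "N \<le> n" for m n
    proof -
      have le: "1 / real (Suc i) < e / 3" if "N \<le> i" for i
        using that N by (smt (verit) Suc_le_mono frac_le of_nat_0_less_iff of_nat_mono zero_less_Suc)
      have "norm (x m - x n) \<le> 2 * (e / 3)"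
      proof (rule norm_le_if_lattice_characters)
        fix k :: "'v \<Rightarrow> real" assume k: "k \<in> lattice_characters"
        show "\<bar>k (x m - x n)\<bar> \<le> 2 * (e / 3)"
          using x[OF k, of m] x[OF k, of n] le[OF mn(1)] le[OF mn(2)]
          unfolding lattice_characterD[OF k] by linarith
      qed
      with \<open>0 < e\<close> show ?thesis by (simp add: dist_norm)
    qed
    then show "\<exists>M. \<forall>m\<ge>M. \<forall>n\<ge>M. dist (x m) (x n) < e" by blast
  qed
  then obtain l where l: "x \<longlonglongrightarrow> l" using Cauchy_convergent convergent_def by blast
  show thesis
  proof (rule that)
    fix k :: "'v \<Rightarrow> real" assume k: "k \<in> lattice_characters"
    have "(\<lambda>n. k (x n)) \<longlonglongrightarrow> k l"
    proof (rule LIM_zero_cancel, rule Lim_null_comparison)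
      show "\<forall>\<^sub>F n in sequentially. norm (k (x n) - k l) \<le> norm (x n - l)"
        using abs_lattice_character_le_norm[OF k] by (simp flip: lattice_characterD(5)[OF k])
      show "(\<lambda>n. norm (x n - l)) \<longlonglongrightarrow> 0" using l by (simp add: LIM_zero tendsto_norm_zero)
    qed
    moreover have "(\<lambda>n. k (x n)) \<longlonglongrightarrow> g k"
    proof (rule LIM_zero_cancel, rule Lim_null_comparison)
      show "\<forall>\<^sub>F n in sequentially. norm (k (x n) - g k) \<le> 1 / real (Suc n)"
        using x[OF k] by (intro always_eventually) (auto simp: abs_minus_commute less_imp_le)
      show "(\<lambda>n. 1 / real (Suc n)) \<longlonglongrightarrow> 0" by (rule LIMSEQ_Suc[OF lim_1_over_n])
    qed
    ultimately show "g k = k l" using LIMSEQ_unique by blast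
  qed
qed

theorem am_representation_exists:
  "am_representation (top_of_set lattice_characters)
     (\<lambda>x::'v::am_algebra. restrict (\<lambda>k. k x) lattice_characters)"
  unfolding am_representation_def
proof (intro conjI allI)
  let ?X = "lattice_characters :: ('v \<Rightarrow> real) set"
  show "compact_space (top_of_set ?X)"
    using compact_lattice_characters by (intro compact_space_subtopology) simp
  show "Hausdorff_space (top_of_set ?X)"
    using Hausdorff_space_product_topology[of "\<lambda>_::'v. euclideanreal" UNIV]
    by (intro Hausdorff_space_subtopology) (simp add: euclidean_product_topology)
  have cont: "continuous_on ?X (\<lambda>k. k x)" for x
    by (rule continuous_on_subset[OF continuous_on_product_coordinates]) simp
  show "range (\<lambda>x::'v. restrict (\<lambda>k. k x) ?X) = C_space (top_of_set ?X)"
  proof (intro equalityI subsetI)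
    fix f assume "f \<in> range (\<lambda>x::'v. restrict (\<lambda>k. k x) ?X)"
    then show "f \<in> C_space (top_of_set ?X)"
      using cont by (auto simp: C_space_def cong: continuous_on_cong)
  next
    fix f assume "f \<in> C_space (top_of_set ?X)"
    then have f: "f \<in> extensional ?X" "continuous_on ?X f" by (auto simp: C_space_def)
    obtain x where "\<And>k. k \<in> ?X \<Longrightarrow> f k = k x" using lattice_characters_surj[OF f(2)] by blast
    then have "f = restrict (\<lambda>k. k x) ?X" using f(1) by (intro extensionalityI[where A = ?X]) auto
    then show "f \<in> range (\<lambda>x::'v. restrict (\<lambda>k. k x) ?X)" by blast
  qed
  show "norm x = (SUP k\<in>topspace (top_of_set ?X). \<bar>restrict (\<lambda>k. k x) ?X k\<bar>)" for x
  proof -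
    obtain k where k: "k \<in> ?X" "\<bar>k x\<bar> = norm x" by (rule lattice_character_norming)
    have "(SUP k\<in>?X. \<bar>k x\<bar>) = norm x"
      using k abs_lattice_character_le_norm by (intro cSup_eq_maximum) force+
    then show ?thesis by simp
  qed
qed (auto simp: lattice_characterD lattice_character_mult lattice_character_inf)

section \<open>The order dual and its order continuous part\<close>

lemma order_dualD:
  assumes "f \<in> order_dual"
  shows "linear f" "bounded (f ` {a..b})"
  using assms by (auto simp: order_dual_def)

lemma pos_functional_mono: "linear f \<Longrightarrow> pos_functional f \<Longrightarrow> x \<le> y \<Longrightarrow> f x \<le> f y"
  by (metis diff_ge_0_iff_ge linear_diff pos_functional_def)

lemma pos_functional_abs_le:
  assumes "linear f" "pos_functional f" "\<bar>x\<bar> \<le> y"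
  shows "\<bar>f x\<bar> \<le> f y"
proof -
  have "x \<le> y" "- x \<le> y" using assms(3) by (auto simp: abs_le_iff)
  then have "f x \<le> f y" "- f x \<le> f y"
    using pos_functional_mono[OF assms(1,2)] linear_neg[OF assms(1)] by metis+
  then show ?thesis by simp
qed

lemma pos_functional_in_order_dual:
  assumes "linear f" "pos_functional f"
  shows "f \<in> order_dual"
proof -
  have "f ` {a..b} \<subseteq> {f a..f b}" for a b using pos_functional_mono[OF assms] by auto
  then have "bounded (f ` {a..b})" for a b by (rule bounded_subset[OF bounded_closed_interval])
  with assms(1) show ?thesis by (simp add: order_dual_def)
qed

lemma order_dual_add:
  assumes "f \<in> order_dual" "g \<in> order_dual"
  shows "(\<lambda>x. f x + g x) \<in> order_dual"
  using assms by (auto simp: order_dual_def linear_compose_add intro: bounded_plus_comp)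

lemma order_dual_uminus:
  assumes "f \<in> order_dual"
  shows "(\<lambda>x. - f x) \<in> order_dual"
  using assms by (auto simp: order_dual_def linear_compose_neg bounded_minus_comp)

lemma dual_le_trans: "dual_le f g \<Longrightarrow> dual_le g h \<Longrightarrow> dual_le f h"
  unfolding dual_le_def by (meson order_trans)

lemma linear_eq_on_cone:
  fixes f g :: "'v::banach_lattice \<Rightarrow> real"
  assumes "linear f" "linear g" "\<And>x. 0 \<le> x \<Longrightarrow> f x = g x"
  shows "f = g"
proof
  fix x :: 'v
  obtain u v where "0 \<le> u" "0 \<le> v" "x = u - v" by (rule nonneg_decomposition[of x])
  then show "f x = g x" using assms by (simp add: linear_diff)
qed

lemma dual_le_antisym:
  assumes "linear f" "linear g" "dual_le f g" "dual_le g f"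
  shows "f = g"
  using assms by (intro linear_eq_on_cone) (auto simp: dual_le_def intro: antisym)

text \<open>Kantorovich extension: \<open>S u - S v\<close> does not depend on the decomposition
  \<open>x = u - v\<close>, because two decompositions satisfy \<open>u + v' = u' + v\<close> and
  \<open>S\<close> is additive on the cone.\<close>

lemma extend_from_cone:
  fixes S :: "'v::banach_lattice \<Rightarrow> real"
  assumes add: "\<And>x y. 0 \<le> x \<Longrightarrow> 0 \<le> y \<Longrightarrow> S (x + y) = S x + S y"
    and scale: "\<And>c x. 0 \<le> c \<Longrightarrow> 0 \<le> x \<Longrightarrow> S (c *\<^sub>R x) = c * S x"
  obtains h where "linear h" "\<And>x. 0 \<le> x \<Longrightarrow> h x = S x"
proof -
  define h where "h x = S (pprt x) - S (- nprt x)" for x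
  have h: "h x = S u - S v" if "0 \<le> u" "0 \<le> v" "x = u - v" for x u v
  proof -
    have "pprt x + v = (pprt x + nprt x) + v + - nprt x" by simp
    also have "\<dots> = u + - nprt x" unfolding prts[of x, symmetric] using that(3) by simp
    finally have "pprt x + v = u + - nprt x" .
    then have "S (pprt x) + S v = S u + S (- nprt x)"
      using that by (metis add zero_le_pprt nprt_le_zero neg_0_le_iff_le)
    then show ?thesis by (simp add: h_def)
  qed
  have "h (x + y) = h x + h y" for x y
  proof -
    obtain u v where x: "0 \<le> u" "0 \<le> v" "x = u - v" by (rule nonneg_decomposition[of x])
    obtain u' v' where y: "0 \<le> u'" "0 \<le> v'" "y = u' - v'" by (rule nonneg_decomposition[of y])
    have "h (x + y) = S (u + u') - S (v + v')" using x y by (intro h) auto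
    then show ?thesis using x(1,2) y(1,2) by (simp only: h[OF x] h[OF y] add)
  qed
  moreover have "h (c *\<^sub>R x) = c *\<^sub>R h x" for c x
  proof -
    obtain u v where x: "0 \<le> u" "0 \<le> v" "x = u - v" by (rule nonneg_decomposition[of x])
    show ?thesis
    proof (cases "0 \<le> c")
      case True
      then have "h (c *\<^sub>R x) = S (c *\<^sub>R u) - S (c *\<^sub>R v)"
        using x by (intro h scaleR_nonneg_nonneg) (auto simp: scaleR_diff_right)
      then show ?thesis using True x(1,2) by (simp only: h[OF x] scale) (simp add: right_diff_distrib)
    next
      case False
      then have "h (c *\<^sub>R x) = S ((- c) *\<^sub>R v) - S ((- c) *\<^sub>R u)"
        using x by (intro h scaleR_nonneg_nonneg) (auto simp: scaleR_diff_right)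
      also have "\<dots> = (- c) * S v - (- c) * S u"
        using scale[of "- c" u] scale[of "- c" v] False x(1,2) by simp
      finally show ?thesis unfolding h[OF x] by (simp add: algebra_simps)
    qed
  qed
  ultimately have "linear h" by (rule linearI)
  moreover have "h x = S x" if "0 \<le> x" for x
    using h[OF that order_refl, of x] scale[of 0 0] by simp
  ultimately show thesis by (rule that)
qed

text \<open>The first summand takes as much of \<open>z\<close> as fits below \<open>x\<close>; the
  rest is at most \<open>y\<close> because \<open>z - y\<close> lies below both \<open>z\<close> and
  \<open>x\<close>.\<close>

lemma riesz_decomposition:
  fixes x y z :: "'v::lattice_ab_group_add"
  assumes "0 \<le> x" "0 \<le> y" "0 \<le> z" "z \<le> x + y"
  obtains u v where "z = u + v" "0 \<le> u" "u \<le> x" "0 \<le> v" "v \<le> y"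
proof (rule that[of "inf z x" "z - inf z x"])
  have "z - y \<le> inf z x" using assms by (simp add: diff_le_eq add.commute)
  then show "z - inf z x \<le> y" by (simp only: diff_le_eq add.commute)
qed (use assms in \<open>simp_all del: diff_inf_eq_sup\<close>)

text \<open>The Riesz--Kantorovich formula. Boundedness on order intervals makes the suprema finite,
  and Riesz decomposition of the elements of \<open>[0, x + y]\<close> makes them additive on the
  cone.\<close>

lemma positive_part_exists:
  assumes f: "f \<in> order_dual"
  obtains h where "linear h" "pos_functional h" "dual_le f h"
    "\<And>k. pos_functional k \<Longrightarrow> linear k \<Longrightarrow> dual_le f k \<Longrightarrow> dual_le h k"
    "\<And>x. 0 \<le> x \<Longrightarrow> h x = (SUP y\<in>{0..x}. f y)"
proof -
  define S where "S x = (SUP y\<in>{0..x}. f y)" for x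
  have lin: "linear f" using f by (rule order_dualD)
  have bdd: "bdd_above (f ` {0..x})" for x
    using f by (intro bounded_imp_bdd_above order_dualD)
  have upper: "f y \<le> S x" if "0 \<le> y" "y \<le> x" for x y
    unfolding S_def using that by (intro cSUP_upper bdd) auto
  have least: "S x \<le> m" if "0 \<le> x" "\<And>y. 0 \<le> y \<Longrightarrow> y \<le> x \<Longrightarrow> f y \<le> m" for x m
    unfolding S_def using that by (intro cSUP_least) auto
  have S_add: "S (x + y) = S x + S y" if xy: "0 \<le> x" "0 \<le> y" for x y
  proof (rule antisym)
    show "S (x + y) \<le> S x + S y"
    proof (rule least)
      fix z assume "0 \<le> z" "z \<le> x + y"
      then obtain u v where "z = u + v" "0 \<le> u" "u \<le> x" "0 \<le> v" "v \<le> y"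
        using riesz_decomposition[OF xy] by blast
      then show "f z \<le> S x + S y" using upper by (simp add: linear_add[OF lin] add_mono)
    qed (use xy in simp)
    have "S x \<le> S (x + y) - S y"
    proof (rule least[OF xy(1)])
      fix u assume u: "0 \<le> u" "u \<le> x"
      have "S y \<le> S (x + y) - f u"
      proof (rule least[OF xy(2)])
        fix v assume "0 \<le> v" "v \<le> y"
        then have "f (u + v) \<le> S (x + y)" using u by (intro upper add_mono add_nonneg_nonneg)
        then show "f v \<le> S (x + y) - f u" by (simp add: linear_add[OF lin])
      qed
      then show "f u \<le> S (x + y) - S y" by simp
    qed
    then show "S x + S y \<le> S (x + y)" by simp
  qed
  have S_scale: "S (c *\<^sub>R x) = c * S x" if "0 \<le> c" and x: "0 \<le> x" for c x
  proof (cases "c = 0")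
    case True
    then show ?thesis by (simp add: S_def linear_0[OF lin])
  next
    case False
    have le: "c * S x \<le> S (c *\<^sub>R x)" if c: "0 < c" and x: "0 \<le> x" for c x
    proof -
      have "S x \<le> S (c *\<^sub>R x) / c"
      proof (rule least[OF x])
        fix y assume "0 \<le> y" "y \<le> x"
        then have "f (c *\<^sub>R y) \<le> S (c *\<^sub>R x)"
          using c by (intro upper scaleR_nonneg_nonneg scaleR_left_mono) auto
        then show "f y \<le> S (c *\<^sub>R x) / c" using c by (simp add: linear_scale[OF lin] field_simps)
      qed
      then show ?thesis using c by (simp add: field_simps)
    qed
    have c: "0 < c" using False \<open>0 \<le> c\<close> by simp
    then have "inverse c * S (c *\<^sub>R x) \<le> S x"
      using le[of "inverse c" "c *\<^sub>R x"] x by (simp add: scaleR_nonneg_nonneg)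
    then show ?thesis using le[OF c x] c by (simp add: field_simps)
  qed
  obtain h where h: "linear h" "\<And>x. 0 \<le> x \<Longrightarrow> h x = S x"
    using extend_from_cone[of S] S_add S_scale by blast
  show thesis
  proof (rule that[OF h(1)])
    show "pos_functional h"
      using upper[of 0] by (auto simp: pos_functional_def h(2) linear_0[OF lin])
    show "dual_le f h" using upper by (auto simp: dual_le_def h(2))
    show "dual_le h k" if "pos_functional k" "linear k" "dual_le f k" for k
      unfolding dual_le_def
    proof (intro allI impI)
      fix x :: 'a assume x: "0 \<le> x"
      have "S x \<le> k x"
      proof (rule least[OF x])
        fix y assume "0 \<le> y" "y \<le> x"
        then show "f y \<le> k x"
          using that pos_functional_mono[of k y x] by (auto simp: dual_le_def intro: order_trans)
      qed
      then show "h x \<le> k x" using x by (simp add: h(2))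
    qed
    show "h x = (SUP y\<in>{0..x}. f y)" if "0 \<le> x" for x
      using that by (simp add: h(2) S_def)
  qed
qed

section \<open>Lattice operations and order continuity in the dual\<close>

lemma dual_sup_eqI:
  assumes "h \<in> order_dual" "dual_le f h" "dual_le g h"
    "\<And>k. k \<in> order_dual \<Longrightarrow> dual_le f k \<Longrightarrow> dual_le g k \<Longrightarrow> dual_le h k"
  shows "dual_sup f g = h"
  unfolding dual_sup_def
  by (rule the_equality) (use assms in \<open>auto intro: dual_le_antisym order_dualD\<close>)

lemma dual_inf_eqI:
  assumes "h \<in> order_dual" "dual_le h f" "dual_le h g"
    "\<And>k. k \<in> order_dual \<Longrightarrow> dual_le k f \<Longrightarrow> dual_le k g \<Longrightarrow> dual_le k h"
  shows "dual_inf f g = h"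
  unfolding dual_inf_def
  by (rule the_equality) (use assms in \<open>auto intro: dual_le_antisym order_dualD\<close>)

lemma dual_abs_pos:
  assumes "f \<in> order_dual" "pos_functional f"
  shows "dual_abs f = f"
  unfolding dual_abs_def using assms
  by (intro dual_sup_eqI) (auto simp: dual_le_def pos_functional_def intro: order_trans)

text \<open>Positivity gives \<open>\<bar>f (x b)\<bar> \<le> f (y b)\<close> for the dominating
  net, so only nets decreasing to zero have to be tested.\<close>

lemma order_continuousI:
  fixes f :: "'v::banach_lattice \<Rightarrow> real"
  assumes f: "linear f" "pos_functional f"
    and *: "\<And>A le (y :: 'v \<Rightarrow> 'v) e. directed_set (A :: 'v set) le \<Longrightarrow> decreases_to_zero A le y \<Longrightarrow>
      0 < e \<Longrightarrow> \<exists>a\<in>A. \<forall>b\<in>A. le a b \<longrightarrow> f (y b) < e"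
  shows "order_continuous f"
  unfolding order_continuous_def
proof (intro allI impI, elim conjE)
  fix A :: "'v set" and le and x :: "'v \<Rightarrow> 'v" and e :: real
  assume A: "directed_set A le" and "order_null A le x" and e: "0 < e"
  then obtain y where y: "decreases_to_zero A le y" "\<And>a. a \<in> A \<Longrightarrow> \<bar>x a\<bar> \<le> y a"
    by (auto simp: order_null_def)
  from *[OF A y(1) e] obtain a where "a \<in> A" "\<forall>b\<in>A. le a b \<longrightarrow> f (y b) < e" by blast
  then show "\<exists>a\<in>A. \<forall>b\<in>A. le a b \<longrightarrow> \<bar>f (x b)\<bar> < e"
    using pos_functional_abs_le[OF f y(2)] by (intro bexI[of _ a]) (auto intro: le_less_trans)
qed

lemma order_continuousD:
  fixes y :: "'v::banach_lattice \<Rightarrow> 'v"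
  assumes "order_continuous f" "directed_set A le" "decreases_to_zero A le y" "0 < e"
  obtains a where "a \<in> A" "\<And>b. b \<in> A \<Longrightarrow> le a b \<Longrightarrow> \<bar>f (y b)\<bar> < e"
proof -
  have "order_null A le y"
    unfolding order_null_def using assms(3)
    by (intro exI[of _ y]) (auto simp: decreases_to_zero_def)
  then show thesis using assms that unfolding order_continuous_def by blast
qed

lemma directed_setD:
  assumes "directed_set A le" "a \<in> A" "b \<in> A"
  obtains c where "c \<in> A" "\<And>d. d \<in> A \<Longrightarrow> le c d \<Longrightarrow> le a d \<and> le b d"
  using assms unfolding directed_set_def by metis

lemma order_continuous_add:
  fixes f g :: "'v::banach_lattice \<Rightarrow> real"
  assumes "order_continuous f" "order_continuous g"
  shows "order_continuous (\<lambda>x. f x + g x)"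
  unfolding order_continuous_def
proof (intro allI impI)
  fix A :: "'v set" and le and x :: "'v \<Rightarrow> 'v" and e :: real
  assume A: "directed_set A le \<and> order_null A le x" and "0 < e"
  then have e: "0 < e / 2" by simp
  obtain a where a: "a \<in> A" "\<And>b. b \<in> A \<Longrightarrow> le a b \<Longrightarrow> \<bar>f (x b)\<bar> < e / 2"
    using assms(1) A e unfolding order_continuous_def by metis
  obtain a' where a': "a' \<in> A" "\<And>b. b \<in> A \<Longrightarrow> le a' b \<Longrightarrow> \<bar>g (x b)\<bar> < e / 2"
    using assms(2) A e unfolding order_continuous_def by metis
  obtain c where c: "c \<in> A" "\<And>d. d \<in> A \<Longrightarrow> le c d \<Longrightarrow> le a d \<and> le a' d"
    using directed_setD A a(1) a'(1) by metis
  have "\<bar>f (x d) + g (x d)\<bar> < e" if "d \<in> A" "le c d" for d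
    using a(2)[of d] a'(2)[of d] c(2)[OF that] that(1) abs_triangle_ineq[of "f (x d)" "g (x d)"]
    by simp
  then show "\<exists>a\<in>A. \<forall>b\<in>A. le a b \<longrightarrow> \<bar>f (x b) + g (x b)\<bar> < e" using c(1) by blast
qed

lemma order_continuous_uminus: "order_continuous f \<Longrightarrow> order_continuous (\<lambda>x. - f x)"
  by (simp add: order_continuous_def)

lemma order_continuous_dominated:
  fixes h k :: "'v::banach_lattice \<Rightarrow> real"
  assumes "linear h" "pos_functional h" "dual_le h k" "order_continuous k"
  shows "order_continuous h"
proof (rule order_continuousI[OF assms(1,2)])
  fix A :: "'v set" and le and y :: "'v \<Rightarrow> 'v" and e :: real
  assume *: "directed_set A le" "decreases_to_zero A le y" "0 < e"
  obtain a where a: "a \<in> A" "\<And>b. b \<in> A \<Longrightarrow> le a b \<Longrightarrow> \<bar>k (y b)\<bar> < e"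
    using order_continuousD[OF assms(4) *] by blast
  have "h (y b) < e" if "b \<in> A" "le a b" for b
  proof -
    have "h (y b) \<le> k (y b)"
      using assms(3) *(2) that(1) by (auto simp: dual_le_def decreases_to_zero_def)
    then show ?thesis using a(2)[OF that] by linarith
  qed
  with a(1) show "\<exists>a\<in>A. \<forall>b\<in>A. le a b \<longrightarrow> h (y b) < e" by blast
qed

lemma decreases_to_zero_inf:
  fixes z :: "'v::banach_lattice"
  assumes "decreases_to_zero A le y" "0 \<le> z"
  shows "decreases_to_zero A le (\<lambda>b. inf z (y b))"
  using assms unfolding decreases_to_zero_def
  by (auto intro: le_infI2)

text \<open>
  If \<open>0 \<le> z \<le> y a\<close> nearly attains the supremum defining \<open>h (y a)\<close>, then for \<open>b\<close> beyond \<open>a\<close> the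
  element \<open>z - inf z (y b)\<close> lies in \<open>[0, y a - y b]\<close>, so
  \<open>h (y b) \<le> h (y a) - g z + g (inf z (y b))\<close>, and the last term tends to zero.
\<close>

lemma order_continuous_positive_part:
  fixes g h :: "'v::banach_lattice \<Rightarrow> real"
  assumes g: "g \<in> order_dual" "order_continuous g"
    and h: "linear h" "pos_functional h" "dual_le g h"
      "\<And>x. 0 \<le> x \<Longrightarrow> h x = (SUP y\<in>{0..x}. g y)"
  shows "order_continuous h"
proof (rule order_continuousI[OF h(1,2)])
  fix A :: "'v set" and le and y :: "'v \<Rightarrow> 'v" and e :: real
  assume A: "directed_set A le" and y: "decreases_to_zero A le y" and "0 < e"
  then have e: "0 < e / 2" by simp
  obtain a where a: "a \<in> A" using A by (auto simp: directed_set_def)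
  have ya: "0 \<le> y a" using y a by (simp add: decreases_to_zero_def)
  have "bdd_above (g ` {0..y a})"
    using g(1) by (intro bounded_imp_bdd_above order_dualD)
  moreover have "h (y a) - e / 2 < (SUP z\<in>{0..y a}. g z)" using h(4)[OF ya] e by simp
  ultimately obtain z where z: "0 \<le> z" "z \<le> y a" "h (y a) - e / 2 < g z"
    using ya by (subst (asm) less_cSUP_iff) auto
  obtain a' where a': "a' \<in> A" "\<And>b. b \<in> A \<Longrightarrow> le a' b \<Longrightarrow> \<bar>g (inf z (y b))\<bar> < e / 2"
    using order_continuousD[OF g(2) A decreases_to_zero_inf[OF y z(1)] e] by blast
  obtain c where c: "c \<in> A" "\<And>d. d \<in> A \<Longrightarrow> le c d \<Longrightarrow> le a d \<and> le a' d"
    using directed_setD[OF A a a'(1)] by blast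
  have "h (y b) < e" if b: "b \<in> A" "le c b" for b
  proof -
    have "y b \<le> y a" using y a b c(2) by (auto simp: decreases_to_zero_def)
    have "z + y b - y a \<le> inf z (y b)"
      using z(2) \<open>y b \<le> y a\<close> by (simp add: diff_le_eq add_mono add.commute)
    then have le: "z - inf z (y b) \<le> y a - y b"
      by (simp only: diff_le_eq le_diff_eq algebra_simps)
    have nn: "0 \<le> z - inf z (y b)" by (simp only: diff_ge_0_iff_ge inf_le1)
    have "g z - g (inf z (y b)) = g (z - inf z (y b))"
      by (simp only: linear_diff[OF order_dualD(1)[OF g(1)]])
    also have "\<dots> \<le> h (z - inf z (y b))" using h(3) nn by (simp only: dual_le_def)
    also have "\<dots> \<le> h (y a - y b)" using le by (rule pos_functional_mono[OF h(1,2)])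
    also have "\<dots> = h (y a) - h (y b)" by (rule linear_diff[OF h(1)])
    finally show ?thesis using z(3) a'(2)[of b] c(2)[OF b] b(1) by auto
  qed
  with c(1) show "\<exists>a\<in>A. \<forall>b\<in>A. le a b \<longrightarrow> h (y b) < e" by blast
qed

text \<open>The modulus of \<open>g\<close> is \<open>(2g)\<^sup>+ - g\<close>.\<close>

lemma dual_abs_order_continuous:
  assumes "g \<in> order_cont_dual"
  shows "dual_abs g \<in> order_cont_dual" "pos_functional (dual_abs g)"
proof -
  have g: "g \<in> order_dual" "order_continuous g" using assms by (auto simp: order_cont_dual_def)
  have gg: "(\<lambda>x. g x + g x) \<in> order_dual" "order_continuous (\<lambda>x. g x + g x)"
    by (rule order_dual_add[OF g(1) g(1)], rule order_continuous_add[OF g(2) g(2)])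
  obtain h where h: "linear h" "pos_functional h" "dual_le (\<lambda>x. g x + g x) h"
    "\<And>k. pos_functional k \<Longrightarrow> linear k \<Longrightarrow> dual_le (\<lambda>x. g x + g x) k \<Longrightarrow> dual_le h k"
    "\<And>x. 0 \<le> x \<Longrightarrow> h x = (SUP y\<in>{0..x}. g y + g y)"
    by (rule positive_part_exists[OF gg(1)], rule that, assumption+)
  have hoc: "order_continuous h" using order_continuous_positive_part[OF gg h(1-3,5)] .
  define m where "m x = h x + - g x" for x
  have md: "m \<in> order_dual"
    unfolding m_def by (intro order_dual_add order_dual_uminus pos_functional_in_order_dual h g)
  have moc: "order_continuous m"
    unfolding m_def by (intro order_continuous_add order_continuous_uminus hoc g)
  have le: "dual_le g m" using h(3) by (auto simp: dual_le_def m_def)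
  have le': "dual_le (\<lambda>x. - g x) m" using h(2) by (auto simp: dual_le_def m_def pos_functional_def)
  have "dual_abs g = m"
    unfolding dual_abs_def
  proof (rule dual_sup_eqI[OF md le le'])
    fix k assume k: "k \<in> order_dual" "dual_le g k" "dual_le (\<lambda>x. - g x) k"
    \<comment> \<open>Since \<open>k\<close> dominates both \<open>g\<close> and \<open>- g\<close>,
      the sum \<open>k + g\<close> is a positive majorant of \<open>2g\<close>, and \<open>h\<close>
      is the least one.\<close>
    have "dual_le h (\<lambda>x. k x + g x)"
    proof (rule h(4))
      show "pos_functional (\<lambda>x. k x + g x)"
        using k(3) by (auto simp: dual_le_def pos_functional_def)
      show "linear (\<lambda>x. k x + g x)" using k(1) g(1) by (intro order_dualD order_dual_add)
      show "dual_le (\<lambda>x. g x + g x) (\<lambda>x. k x + g x)" using k(2) by (auto simp: dual_le_def)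
    qed
    then show "dual_le m k" by (auto simp: dual_le_def m_def)
  qed
  moreover have "pos_functional m"
  proof -
    have "0 \<le> m x" if "0 \<le> x" for x
      using le le' that unfolding dual_le_def by (smt (verit))
    then show ?thesis by (simp add: pos_functional_def)
  qed
  ultimately show "dual_abs g \<in> order_cont_dual" "pos_functional (dual_abs g)"
    using md moc by (auto simp: order_cont_dual_def)
qed

text \<open>The upper bound \<open>f\<close> keeps the pointwise suprema finite. Additivity on the
  cone needs one functional above two given ones, which the chain provides.\<close>

lemma chain_supremum:
  fixes C :: "('v::banach_lattice \<Rightarrow> real) set"
  assumes ne: "C \<noteq> {}" and C: "\<And>g. g \<in> C \<Longrightarrow> linear g \<and> dual_le g f"
    and chain: "\<And>g k. g \<in> C \<Longrightarrow> k \<in> C \<Longrightarrow> dual_le g k \<or> dual_le k g"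
  obtains h where "linear h" "\<And>x. 0 \<le> x \<Longrightarrow> h x = (SUP g\<in>C. g x)"
    "\<And>g. g \<in> C \<Longrightarrow> dual_le g h" "dual_le h f"
proof -
  define S where "S x = (SUP g\<in>C. g x)" for x
  have upper: "g x \<le> S x" if "g \<in> C" "0 \<le> x" for g x
    unfolding S_def using that C
    by (intro cSUP_upper bdd_aboveI2[where M = "f x"]) (auto simp: dual_le_def)
  have least: "S x \<le> m" if "\<And>g. g \<in> C \<Longrightarrow> g x \<le> m" for x m
    unfolding S_def using that ne by (intro cSUP_least) auto
  have S_add: "S (x + y) = S x + S y" if xy: "0 \<le> x" "0 \<le> y" for x y
  proof (rule antisym)
    show "S (x + y) \<le> S x + S y"
      using C upper xy by (intro least) (auto simp: linear_add intro: add_mono)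
    have *: "g x + k y \<le> S (x + y)" if gk: "g \<in> C" "k \<in> C" for g k
    proof -
      obtain l where l: "l \<in> C" "dual_le g l" "dual_le k l"
        using chain[OF gk] gk by (auto simp: dual_le_def)
      then have "g x + k y \<le> l x + l y" using xy by (auto simp: dual_le_def intro: add_mono)
      also have "\<dots> = l (x + y)" using C[OF l(1)] by (simp add: linear_add)
      also have "\<dots> \<le> S (x + y)" using l(1) xy by (intro upper) auto
      finally show ?thesis .
    qed
    have "S x \<le> S (x + y) - S y"
    proof (rule least)
      fix g assume g: "g \<in> C"
      have "S y \<le> S (x + y) - g x" using *[OF g] by (intro least) (simp add: algebra_simps)
      then show "g x \<le> S (x + y) - S y" by simp
    qed
    then show "S x + S y \<le> S (x + y)" by simp
  qed
  have S_scale: "S (c *\<^sub>R x) = c * S x" if "0 \<le> c" and x: "0 \<le> x" for c x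
  proof (cases "c = 0")
    case True
    have "(SUP g\<in>C. g (0::'v)) = (SUP g\<in>C. 0)" using C by (intro SUP_cong) (auto simp: linear_0)
    then show ?thesis using True ne by (simp add: S_def)
  next
    case False
    have le: "S (c *\<^sub>R x) \<le> c * S x" if "0 \<le> c" "0 \<le> x" for c x
      using C upper that by (intro least) (auto simp: linear_scale intro: mult_left_mono)
    have c: "0 < c" using False \<open>0 \<le> c\<close> by simp
    then have "S x \<le> inverse c * S (c *\<^sub>R x)"
      using le[of "inverse c" "c *\<^sub>R x"] x by (simp add: scaleR_nonneg_nonneg)
    then show ?thesis using le[OF \<open>0 \<le> c\<close> x] c by (simp add: field_simps)
  qed
  obtain h where h: "linear h" "\<And>x. 0 \<le> x \<Longrightarrow> h x = S x"
    using extend_from_cone[of S] S_add S_scale by blast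
  show thesis
  proof (rule that[OF h(1)])
    show "h x = (SUP g\<in>C. g x)" if "0 \<le> x" for x using h(2)[OF that] by (simp add: S_def)
    show "dual_le g h" if "g \<in> C" for g using upper[OF that] by (simp add: dual_le_def h(2))
    show "dual_le h f"
      using C by (auto simp: dual_le_def h(2) intro!: least)
  qed
qed

text \<open>Some \<open>g\<close> in the chain is within \<open>e / 2\<close> of \<open>h\<close> at
  \<open>y a\<close>. As \<open>h - g\<close> is positive, the gap does not grow when the net
  decreases beyond \<open>a\<close>, while \<open>g (y b)\<close> tends to zero.\<close>

lemma order_continuous_chain_supremum:
  fixes C :: "('v::banach_lattice \<Rightarrow> real) set"
  assumes h: "linear h" "pos_functional h" "\<And>x. 0 \<le> x \<Longrightarrow> h x = (SUP g\<in>C. g x)"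
    and ne: "C \<noteq> {}" and C: "\<And>g. g \<in> C \<Longrightarrow> linear g \<and> dual_le g h \<and> order_continuous g"
  shows "order_continuous h"
proof (rule order_continuousI[OF h(1,2)])
  fix A :: "'v set" and le and y :: "'v \<Rightarrow> 'v" and e :: real
  assume A: "directed_set A le" and y: "decreases_to_zero A le y" and "0 < e"
  then have e: "0 < e / 2" by simp
  obtain a where a: "a \<in> A" using A by (auto simp: directed_set_def)
  have ya: "0 \<le> y a" using y a by (simp add: decreases_to_zero_def)
  have "bdd_above ((\<lambda>g. g (y a)) ` C)"
    using C ya by (intro bdd_aboveI2[where M = "h (y a)"]) (auto simp: dual_le_def)
  moreover have "h (y a) - e / 2 < (SUP g\<in>C. g (y a))" using h(3)[OF ya] e by simp
  ultimately obtain g where g: "g \<in> C" "h (y a) - e / 2 < g (y a)"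
    using ne by (subst (asm) less_cSUP_iff) auto
  have g': "linear g" "dual_le g h" "order_continuous g" using C g(1) by auto
  obtain a' where a': "a' \<in> A" "\<And>b. b \<in> A \<Longrightarrow> le a' b \<Longrightarrow> \<bar>g (y b)\<bar> < e / 2"
    using order_continuousD[OF g'(3) A y e] by blast
  obtain c where c: "c \<in> A" "\<And>d. d \<in> A \<Longrightarrow> le c d \<Longrightarrow> le a d \<and> le a' d"
    using directed_setD[OF A a a'(1)] by blast
  have "h (y b) < e" if b: "b \<in> A" "le c b" for b
  proof -
    have "0 \<le> y a - y b" using y a b c(2) by (auto simp: decreases_to_zero_def)
    then have "g (y a - y b) \<le> h (y a - y b)" using g'(2) by (simp only: dual_le_def)
    then have "g (y a) - g (y b) \<le> h (y a) - h (y b)"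
      by (simp only: linear_diff[OF h(1)] linear_diff[OF g'(1)])
    then show ?thesis using g(2) a'(2)[of b] c(2)[OF b] b(1) by auto
  qed
  with c(1) show "\<exists>a\<in>A. \<forall>b\<in>A. le a b \<longrightarrow> h (y b) < e" by blast
qed

text \<open>
  The order continuous component of \<open>f\<close> is a maximal order continuous functional between \<open>0\<close> and
  \<open>f\<close>; by maximality the remainder has no nonzero order continuous minorant.
\<close>

theorem order_continuous_singular_decomposition:
  fixes f :: "'v::banach_lattice \<Rightarrow> real"
  assumes f: "linear f" "pos_functional f"
  obtains g s where "g \<in> order_cont_dual" "pos_functional g" "s \<in> singular_dual" "pos_functional s"
    "\<And>x. f x = g x + s x"
proof -
  define A where "A = {g. linear g \<and> pos_functional g \<and> dual_le g f \<and> order_continuous g}"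
  have "\<exists>m\<in>A. \<forall>a\<in>A. dual_le m a \<longrightarrow> a = m"
  proof (rule predicate_Zorn)
    show "partial_order_on A (relation_of dual_le A)"
    proof (rule partial_order_on_relation_ofI)
      show "dual_le a a" for a :: "'v \<Rightarrow> real" by (simp add: dual_le_def)
      show "dual_le a c" if "dual_le a b" "dual_le b c" for a b c :: "'v \<Rightarrow> real"
        using that by (rule dual_le_trans)
      show "a = b" if "a \<in> A" "b \<in> A" "dual_le a b" "dual_le b a" for a b
        using that by (intro dual_le_antisym) (auto simp: A_def)
    qed
    fix C assume C: "C \<in> Chains (relation_of dual_le A)"
    show "\<exists>u\<in>A. \<forall>a\<in>C. dual_le a u"
    proof (cases "C = {}")
      case True
      have zero: "linear (\<lambda>_::'v. 0::real)" "pos_functional (\<lambda>_::'v. 0)"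
        by (rule linearI) (simp_all add: pos_functional_def)
      have "order_continuous (\<lambda>_::'v. 0)"
        by (rule order_continuousI[OF zero]) (simp only: directed_set_def, blast)
      then have "(\<lambda>_. 0) \<in> A"
        using f(2) zero by (simp add: A_def dual_le_def pos_functional_def)
      then show ?thesis using True by blast
    next
      case False
      have CA: "\<And>g. g \<in> C \<Longrightarrow> g \<in> A"
        and chain: "\<And>g k. g \<in> C \<Longrightarrow> k \<in> C \<Longrightarrow> dual_le g k \<or> dual_le k g"
        using C by (auto simp: Chains_def relation_of_def)
      obtain h where h: "linear h" "\<And>x. 0 \<le> x \<Longrightarrow> h x = (SUP g\<in>C. g x)"
        "\<And>g. g \<in> C \<Longrightarrow> dual_le g h" "dual_le h f"
        using chain_supremum[of C f] False CA chain unfolding A_def by blast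
      obtain g where "g \<in> C" using False by blast
      then have "pos_functional h"
        using CA[of g] h(3)[of g] by (auto simp: A_def pos_functional_def dual_le_def intro: order_trans)
      moreover have "order_continuous h"
        using order_continuous_chain_supremum[OF h(1) calculation h(2) False] CA h(3)
        by (auto simp: A_def)
      ultimately have "h \<in> A" using h by (simp add: A_def)
      then show ?thesis using h(3) by blast
    qed
  qed
  then obtain m where m: "m \<in> A" and max: "\<And>a. a \<in> A \<Longrightarrow> dual_le m a \<Longrightarrow> a = m" by blast
  then have m': "linear m" "pos_functional m" "dual_le m f" "order_continuous m"
    by (auto simp: A_def)
  define s where "s x = f x - m x" for x
  have s: "linear s" "pos_functional s"
    using m' f by (auto simp: s_def[abs_def] linear_compose_sub pos_functional_def dual_le_def)
  have sd: "s \<in> order_dual" using s by (rule pos_functional_in_order_dual)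
  have "s \<in> singular_dual"
    unfolding singular_dual_def mem_Collect_eq
  proof (intro conjI ballI sd)
    fix g :: "'v \<Rightarrow> real" assume "g \<in> order_cont_dual"
    then have G: "dual_abs g \<in> order_cont_dual" "pos_functional (dual_abs g)"
      by (rule dual_abs_order_continuous)+
    then have G': "linear (dual_abs g)" "order_continuous (dual_abs g)"
      by (auto simp: order_cont_dual_def order_dualD)
    show "dual_inf (dual_abs s) (dual_abs g) = (\<lambda>x. 0)"
      unfolding dual_abs_pos[OF sd s(2)]
    proof (rule dual_inf_eqI)
      show "(\<lambda>x. 0) \<in> order_dual"
        by (intro pos_functional_in_order_dual) (auto simp: linear_zero pos_functional_def)
      show "dual_le (\<lambda>x. 0) s" "dual_le (\<lambda>x. 0) (dual_abs g)"
        using s(2) G(2) by (auto simp: dual_le_def pos_functional_def)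
      fix k assume k: "k \<in> order_dual" "dual_le k s" "dual_le k (dual_abs g)"
      \<comment> \<open>The common lower bound \<open>k\<close> may change sign. Its positive part
        still lies below \<open>s\<close> and \<open>dual_abs g\<close>, which are positive, and is
        order continuous by domination.\<close>
      obtain h where h: "linear h" "pos_functional h" "dual_le k h"
        "\<And>l. pos_functional l \<Longrightarrow> linear l \<Longrightarrow> dual_le k l \<Longrightarrow> dual_le h l"
        "\<And>x. 0 \<le> x \<Longrightarrow> h x = (SUP y\<in>{0..x}. k y)"
        by (rule positive_part_exists[OF k(1)], rule that, assumption+)
      have "dual_le h s" using h(4)[OF s(2,1) k(2)] .
      moreover have "order_continuous h"
        using h(4)[OF G(2) G'(1) k(3)] by (rule order_continuous_dominated[OF h(1,2) _ G'(2)])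
      \<comment> \<open>From \<open>h \<le> s = f - m\<close> the sum \<open>m + h\<close> stays
        below \<open>f\<close>; maximality of \<open>m\<close> then forces
        \<open>h = 0\<close>.\<close>
      ultimately have "(\<lambda>x. m x + h x) \<in> A"
        using m' h unfolding A_def s_def dual_le_def pos_functional_def
        by (auto simp: linear_compose_add intro!: order_continuous_add)
      then have "(\<lambda>x. m x + h x) = m"
        using h(2) by (intro max) (auto simp: dual_le_def pos_functional_def)
      then have "h x = 0" for x by (metis add_cancel_right_right)
      with h(3) show "dual_le k (\<lambda>x. 0)" by (simp add: dual_le_def)
    qed
  qed
  moreover have "m \<in> order_cont_dual"
    using m' by (simp add: order_cont_dual_def pos_functional_in_order_dual)
  ultimately show thesis using m' s by (intro that[of m s]) (auto simp: s_def)
qed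

section \<open>Functional calculus\<close>

definition am_points :: "('v::am_algebra \<Rightarrow> real) set" where
  "am_points = topspace (fst (am_rep :: ('v \<Rightarrow> real) topology \<times> ('v \<Rightarrow> ('v \<Rightarrow> real) \<Rightarrow> real)))"

definition am_eval :: "'v::am_algebra \<Rightarrow> ('v \<Rightarrow> real) \<Rightarrow> real" where
  "am_eval = snd am_rep"

text \<open>Nothing identifies the chosen representation with the one on characters. The existence
  theorem serves only to make the clauses of \<open>am_representation\<close> available, and the
  calculus is developed from these alone.\<close>

lemma am_representation_am_rep:
  "am_representation (fst am_rep) (am_eval :: 'v::am_algebra \<Rightarrow> ('v \<Rightarrow> real) \<Rightarrow> real)"
proof -
  have "case am_rep of (K, \<Phi> :: 'v \<Rightarrow> ('v \<Rightarrow> real) \<Rightarrow> real) \<Rightarrow> am_representation K \<Phi>"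
    unfolding am_rep_def
    by (rule someI[of _ "(top_of_set lattice_characters, \<lambda>x. restrict (\<lambda>k. k x) lattice_characters)"])
      (simp add: am_representation_exists)
  then show ?thesis by (simp add: am_eval_def case_prod_beta)
qed

lemma
  assumes "k \<in> am_points"
  shows am_eval_add: "am_eval (x + y) k = am_eval x k + am_eval y k"
    and am_eval_scaleR: "am_eval (c *\<^sub>R x) k = c * am_eval x k"
    and am_eval_mult: "am_eval (x * y) k = am_eval x k * am_eval y k"
    and am_eval_sup: "am_eval (sup x y) k = max (am_eval x k) (am_eval y k)"
    and am_eval_one: "am_eval 1 k = 1"
  using am_representation_am_rep[where 'v = 'a] assms
  unfolding am_representation_def am_points_def by blast+

lemma norm_eq_SUP_am_eval: "norm x = (SUP k\<in>am_points. \<bar>am_eval x k\<bar>)"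
  using am_representation_am_rep unfolding am_representation_def am_points_def by blast

lemma range_am_eval: "range am_eval = C_space (fst am_rep)"
  using am_representation_am_rep unfolding am_representation_def by blast

lemma am_points_nonempty: "am_points \<noteq> ({} :: ('v::am_algebra \<Rightarrow> real) set)"
proof
  assume "am_points = ({} :: ('v \<Rightarrow> real) set)"
  \<comment> \<open>Without points both norms would be the supremum of the same empty set of reals,
    an unspecified but fixed number.\<close>
  then have "norm (0::'v) = norm (1::'v)" by (simp only: norm_eq_SUP_am_eval image_empty)
  then show False by simp
qed

lemma am_eval_eqI:
  assumes "\<And>k. k \<in> am_points \<Longrightarrow> am_eval x k = am_eval y k"
  shows "x = y"
proof -
  have "am_eval (x + (- 1) *\<^sub>R y) k = 0" if "k \<in> am_points" for k
    using assms[OF that] unfolding am_eval_add[OF that] am_eval_scaleR[OF that] by simp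
  then have "norm (x + (- 1) *\<^sub>R y) = (SUP k\<in>(am_points :: ('a \<Rightarrow> real) set). 0)"
    unfolding norm_eq_SUP_am_eval by (intro SUP_cong) auto
  also have "\<dots> = 0" by (rule cSUP_const[OF am_points_nonempty])
  finally show ?thesis by simp
qed

lemma le_iff_am_eval: "x \<le> y \<longleftrightarrow> (\<forall>k\<in>am_points. am_eval x k \<le> am_eval y k)"
proof -
  have "x \<le> y \<longleftrightarrow> sup x y = y" by (rule le_iff_sup)
  also have "\<dots> \<longleftrightarrow> (\<forall>k\<in>am_points. am_eval (sup x y) k = am_eval y k)"
    using am_eval_eqI by metis
  finally show ?thesis by (auto simp: am_eval_sup max_def)
qed

text \<open>Continuity puts the composition into the range of \<open>am_eval\<close>, where the
  \<open>inv\<close> in \<open>am_calculus\<close> is a genuine preimage. The set \<open>S\<close>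
  admits functions such as \<open>ln\<close> that are continuous only where the values of
  \<open>x\<close> lie.\<close>

lemma am_calculus_eval:
  fixes x :: "'v::am_algebra"
  assumes g: "continuous_on S g" "\<And>k. k \<in> am_points \<Longrightarrow> am_eval x k \<in> S" and k: "k \<in> am_points"
  shows "am_eval (am_calculus g x) k = g (am_eval x k)"
proof -
  let ?K = "fst (am_rep :: ('v \<Rightarrow> real) topology \<times> ('v \<Rightarrow> ('v \<Rightarrow> real) \<Rightarrow> real))"
  let ?h = "\<lambda>k\<in>am_points. g (am_eval x k)"
  have "am_eval x \<in> C_space ?K" using range_am_eval by blast
  then have "continuous_map ?K (top_of_set S) (am_eval x)"
    using g(2) by (auto simp: C_space_def continuous_map_in_subtopology am_points_def)
  moreover have "continuous_map (top_of_set S) euclideanreal g" using g(1) by simp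
  ultimately have "continuous_map ?K euclideanreal (g \<circ> am_eval x)" by (rule continuous_map_compose)
  then have "continuous_map ?K euclideanreal ?h"
    by (rule continuous_map_eq) (simp add: am_points_def)
  then have "?h \<in> C_space ?K" by (simp add: C_space_def am_points_def)
  then have "am_eval (inv am_eval ?h) = ?h" by (simp add: f_inv_into_f flip: range_am_eval)
  moreover have "am_calculus g x = inv am_eval ?h"
    by (simp add: am_calculus_def am_eval_def am_points_def case_prod_beta)
  ultimately show ?thesis using k by simp
qed

section \<open>Exponential, logarithm and powers\<close>

lemma am_eval_am_exp: "k \<in> am_points \<Longrightarrow> am_eval (am_exp x) k = exp (am_eval x k)"
  unfolding am_exp_def by (rule am_calculus_eval[of UNIV]) (auto intro: continuous_intros)

text \<open>For the order unit norm, the closed ball of radius \<open>c\<close> about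
  \<open>x\<close> is the order interval from \<open>x - c *\<^sub>R 1\<close> to
  \<open>x + c *\<^sub>R 1\<close>, so only its lower end matters.\<close>

lemma int_cone_iff: "x \<in> int_cone \<longleftrightarrow> (\<exists>c>0. c *\<^sub>R 1 \<le> (x :: 'v::am_algebra))"
proof
  assume "x \<in> int_cone"
  then obtain e where e: "0 < e" "cball x e \<subseteq> {x. 0 \<le> x}"
    unfolding int_cone_def mem_interior_cball by blast
  have "x - e *\<^sub>R 1 \<in> cball x e" using e(1) by (simp add: dist_norm)
  then have "0 \<le> x - e *\<^sub>R 1" using e(2) by blast
  then have "e *\<^sub>R 1 \<le> x" by (simp only: diff_ge_0_iff_ge)
  then show "\<exists>c>0. c *\<^sub>R 1 \<le> x" using e(1) by blast
next
  assume "\<exists>c>0. c *\<^sub>R 1 \<le> x"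
  then obtain c where c: "0 < c" "c *\<^sub>R 1 \<le> x" by blast
  have "0 \<le> y" if "y \<in> cball x c" for y
  proof -
    have "norm (x - y) \<le> c" using that by (simp add: dist_norm)
    then have "x - y \<le> c *\<^sub>R 1"
      unfolding norm_le_iff_abs_le using abs_ge_self order_trans by blast
    then have "x \<le> y + c *\<^sub>R 1" by (simp only: diff_le_eq add.commute)
    with c(2) have "c *\<^sub>R 1 \<le> y + c *\<^sub>R 1" by (rule order_trans)
    then show "0 \<le> y" by simp
  qed
  then show "x \<in> int_cone" unfolding int_cone_def mem_interior_cball using c(1) by blast
qed

lemma int_cone_am_eval_pos:
  assumes "x \<in> int_cone" "k \<in> am_points"
  shows "0 < am_eval x k"
proof -
  obtain c where "0 < c" "c *\<^sub>R 1 \<le> x" using assms(1) by (auto simp: int_cone_iff)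
  then have "c \<le> am_eval x k"
    using assms(2) by (auto simp: le_iff_am_eval am_eval_scaleR am_eval_one)
  with \<open>0 < c\<close> show ?thesis by simp
qed

lemma am_exp_le_iff [simp]: "am_exp u \<le> am_exp v \<longleftrightarrow> u \<le> v"
  by (auto simp: le_iff_am_eval am_eval_am_exp)

lemma am_exp_add_scaleR_one: "am_exp (u + c *\<^sub>R 1) = exp c *\<^sub>R am_exp u"
  by (rule am_eval_eqI)
    (simp add: am_eval_am_exp am_eval_add am_eval_scaleR am_eval_one exp_add)

lemma am_exp_0 [simp]: "am_exp 0 = 1"
proof (rule am_eval_eqI)
  fix k :: "'a \<Rightarrow> real" assume k: "k \<in> am_points"
  then have "am_eval 0 k = 0" using am_eval_scaleR[OF k, of 0 0] by simp
  with k show "am_eval (am_exp 0) k = am_eval 1 k" by (simp add: am_eval_am_exp am_eval_one)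
qed

lemma am_exp_in_int_cone [simp]: "am_exp u \<in> int_cone"
proof -
  have "0 + (- norm u) *\<^sub>R 1 \<le> u" using minus_norm_le[of u] by simp
  then have "am_exp (0 + (- norm u) *\<^sub>R 1) \<le> am_exp u" by (simp only: am_exp_le_iff)
  then have "exp (- norm u) *\<^sub>R 1 \<le> am_exp u" by (simp only: am_exp_add_scaleR_one am_exp_0)
  then show ?thesis unfolding int_cone_iff by (intro exI[of _ "exp (- norm u)"]) simp
qed

lemma am_exp_inject [simp]: "am_exp u = am_exp v \<longleftrightarrow> u = v"
  by (metis am_exp_le_iff antisym order_refl)

lemma am_exp_surj:
  assumes "x \<in> int_cone"
  obtains u where "x = am_exp u"
proof (rule that)
  \<comment> \<open>As \<open>am_log\<close> is merely \<open>inv am_exp\<close>, surjectivity needs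
    a witness from the calculus; the values of \<open>x\<close> lie in \<open>{0<..}\<close>, where
    \<open>ln\<close> is continuous.\<close>
  show "x = am_exp (am_calculus ln x)"
  proof (rule am_eval_eqI)
    fix k :: "'a \<Rightarrow> real" assume k: "k \<in> am_points"
    have "continuous_on {0<..} (ln :: real \<Rightarrow> real)" by (intro continuous_intros) auto
    then have "am_eval (am_calculus ln x) k = ln (am_eval x k)"
      by (rule am_calculus_eval) (use k int_cone_am_eval_pos[OF assms] in auto)
    then show "am_eval x k = am_eval (am_exp (am_calculus ln x)) k"
      using k int_cone_am_eval_pos[OF assms k] by (simp add: am_eval_am_exp)
  qed
qed

lemma am_log_am_exp [simp]: "am_log (am_exp u) = u"
  unfolding am_log_def by (rule inv_f_f) (simp add: inj_on_def)

lemma am_exp_am_log: "x \<in> int_cone \<Longrightarrow> am_exp (am_log x) = x"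
  by (metis am_exp_surj am_log_am_exp)

lemma am_power_am_exp:
  assumes "t \<noteq> 0"
  shows "am_power (am_exp u) t = am_exp (t *\<^sub>R u)"
proof (rule am_eval_eqI)
  fix k :: "'a \<Rightarrow> real" assume k: "k \<in> am_points"
  have "am_eval (am_power (am_exp u) t) k = am_eval (am_exp u) k powr t"
    unfolding am_power_def if_not_P[OF assms]
    by (rule am_calculus_eval[of "{0<..}"])
      (use k in \<open>auto intro!: continuous_intros simp: am_eval_am_exp\<close>)
  then show "am_eval (am_power (am_exp u) t) k = am_eval (am_exp (t *\<^sub>R u)) k"
    using k by (simp add: am_eval_am_exp am_eval_scaleR powr_def)
qed

lemma am_exp_mult: "am_exp u * am_exp v = am_exp (u + v)"
  by (rule am_eval_eqI) (simp add: am_eval_am_exp am_eval_mult am_eval_add exp_add)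

section \<open>Logarithmic coordinates\<close>

text \<open>A logarithm of norm \<open>1\<close> lies below the unit, and monotonicity of
  \<open>f\<close> does the rest. A supremum equal to Euler's number thus means
  \<open>f 1 = 1\<close>.\<close>

lemma SUP_exp_pos_functional:
  fixes f :: "'v::am_algebra \<Rightarrow> real"
  assumes f: "linear f" "pos_functional f"
  shows "(SUP x\<in>{x. 1 \<le> x \<and> norm (am_log x) = 1}. ereal (exp (f (am_log x)))) = ereal (exp (f 1))"
proof (rule antisym)
  show "(SUP x\<in>{x. 1 \<le> x \<and> norm (am_log x) = 1}. ereal (exp (f (am_log x)))) \<le> ereal (exp (f 1))"
  proof (rule SUP_least)
    fix x :: 'v assume "x \<in> {x. 1 \<le> x \<and> norm (am_log x) = 1}"
    then have "am_log x \<le> 1" using le_norm[of "am_log x"] by simp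
    then show "ereal (exp (f (am_log x))) \<le> ereal (exp (f 1))"
      using pos_functional_mono[OF f] by simp
  qed
  have "(0::'v) \<le> 1" using unit_pos[where 'a = 'v] by (rule less_imp_le)
  then have "(1::'v) \<le> am_exp 1" using am_exp_le_iff[of "0::'v" 1] by simp
  then show "ereal (exp (f 1)) \<le>
      (SUP x\<in>{x. 1 \<le> x \<and> norm (am_log x) = 1}. ereal (exp (f (am_log x))))"
    by (intro SUP_upper2[of "am_exp 1"]) auto
qed

lemma one_le_in_int_cone: "1 \<le> x \<Longrightarrow> x \<in> int_cone"
  unfolding int_cone_iff by (intro exI[of _ 1]) simp

lemma GG_dual_setD:
  fixes l :: "'v::am_algebra \<Rightarrow> real"
  assumes "l \<in> GG_dual_set"
  obtains f where "linear f" "pos_functional f" "f 1 = 1" "\<And>u. l (am_exp u) = exp (f u)"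
proof -
  obtain lc ls where l: "l = (\<lambda>x\<in>int_cone. lc x * ls x)"
    and lc: "lc \<in> GG_cont_dual" and ls: "ls \<in> GG_sing_dual"
    and SUP: "(SUP x\<in>{x. 1 \<le> x \<and> norm (am_log x) = 1}. ereal (lc x * ls x)) = ereal (exp 1)"
    using assms by (auto simp: GG_dual_set_def)
  define f where "f u = ln (lc (am_exp u)) + ln (ls (am_exp u))" for u
  have lc': "(\<lambda>v. ln (lc (am_exp v))) \<in> order_dual" "pos_functional (\<lambda>v. ln (lc (am_exp v)))"
    using lc by (auto simp: GG_cont_dual_def order_cont_dual_def)
  have ls': "(\<lambda>v. ln (ls (am_exp v))) \<in> order_dual" "pos_functional (\<lambda>v. ln (ls (am_exp v)))"
    using ls by (auto simp: GG_sing_dual_def singular_dual_def)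
  have f: "linear f" "pos_functional f"
    using linear_compose_add[OF order_dualD(1)[OF lc'(1)] order_dualD(1)[OF ls'(1)]] lc'(2) ls'(2)
    by (auto simp: f_def[abs_def] pos_functional_def)
  have "0 < lc x" "0 < ls x" if "x \<in> int_cone" for x
    using lc ls that by (auto simp: GG_cont_dual_def GG_sing_dual_def PiE_iff)
  then have exp_f: "exp (f u) = lc (am_exp u) * ls (am_exp u)" for u
    by (simp add: f_def exp_add)
  have "(SUP x\<in>{x. 1 \<le> x \<and> norm (am_log x) = 1}. ereal (exp (f (am_log x)))) = ereal (exp 1)"
    unfolding SUP[symmetric]
    by (intro SUP_cong) (auto simp: exp_f am_exp_am_log one_le_in_int_cone)
  then have "f 1 = 1" unfolding SUP_exp_pos_functional[OF f] by simp
  with f show thesis by (rule that) (simp add: l exp_f)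
qed

text \<open>The exponential turns the sum of the order continuous and the singular component of
  \<open>f\<close> into the product \<open>lc x * ls x\<close>.\<close>

lemma GG_dual_setI:
  fixes f :: "'v::am_algebra \<Rightarrow> real"
  assumes f: "linear f" "pos_functional f" "f 1 = 1"
  shows "(\<lambda>x\<in>int_cone. exp (f (am_log x))) \<in> GG_dual_set"
proof -
  obtain g s where g: "g \<in> order_cont_dual" "pos_functional g"
    and s: "s \<in> singular_dual" "pos_functional s" and gs: "\<And>x. f x = g x + s x"
    using order_continuous_singular_decomposition[OF f(1,2)] by blast
  define lc where "lc = (\<lambda>x\<in>int_cone. exp (g (am_log x)))"
  define ls where "ls = (\<lambda>x\<in>int_cone. exp (s (am_log x)))"
  have "lc \<in> GG_cont_dual" "ls \<in> GG_sing_dual"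
    using g s by (auto simp: GG_cont_dual_def GG_sing_dual_def lc_def ls_def)
  moreover have prod: "lc x * ls x = exp (f (am_log x))" if "x \<in> int_cone" for x
    using that by (simp add: lc_def ls_def gs exp_add)
  have "(SUP x\<in>{x. 1 \<le> x \<and> norm (am_log x) = 1}. ereal (lc x * ls x)) = ereal (exp 1)"
    using SUP_exp_pos_functional[OF f(1,2)] f(3)
    by (simp add: prod one_le_in_int_cone cong: SUP_cong_simp conj_cong)
  moreover have "(\<lambda>x\<in>int_cone. exp (f (am_log x))) = (\<lambda>x\<in>int_cone. lc x * ls x)"
    by (rule restrict_ext) (simp add: prod)
  ultimately show ?thesis unfolding GG_dual_set_def by blast
qed

text \<open>
  The functional is obtained from Hahn--Banach applied to the directional derivative \<open>p\<close> of \<open>r\<close>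
  at \<open>u\<close>; replacing the limit at \<open>0\<close> by an infimum avoids the monotonicity of difference quotients.
\<close>

lemma subgradient_exists:
  fixes r :: "'v::am_algebra \<Rightarrow> real"
  assumes mono: "\<And>u v. u \<le> v \<Longrightarrow> r u \<le> r v"
    and cash: "\<And>u c. r (u + c *\<^sub>R 1) = r u + c"
    and convex: "\<And>u v t. 0 < t \<Longrightarrow> t < 1 \<Longrightarrow> r (t *\<^sub>R u + (1 - t) *\<^sub>R v) \<le> t * r u + (1 - t) * r v"
  obtains f where "linear f" "pos_functional f" "f 1 = 1" "\<And>v. f v - r v \<le> f u - r u"
proof -
  define Q where "Q t y = (r (u + t *\<^sub>R y) - r u) / t" for t y
  define p where "p y = (INF t\<in>{0<..}. Q t y)" for y
  \<comment> \<open>Monotonicity and translation give this Lipschitz bound, which keeps the infimum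
    over \<open>t\<close> finite.\<close>
  have Q_lower: "- norm y \<le> Q t y" if t: "0 < t" for t y
  proof -
    have "t *\<^sub>R ((- norm y) *\<^sub>R 1) \<le> t *\<^sub>R y"
      using t minus_norm_le[of y] by (intro scaleR_left_mono) auto
    then have "u + (- (t * norm y)) *\<^sub>R 1 \<le> u + t *\<^sub>R y" by simp
    from mono[OF this] have "- (t * norm y) \<le> r (u + t *\<^sub>R y) - r u" unfolding cash by simp
    then show ?thesis using t by (simp add: Q_def field_simps)
  qed
  have bdd: "bdd_below ((\<lambda>t. Q t y) ` {0<..})" for y
    using Q_lower by (intro bdd_belowI2[where m = "- norm y"]) auto
  have p_le: "p y \<le> Q t y" if "0 < t" for t y
    unfolding p_def using that by (intro cINF_lower bdd) auto
  have p_greatest: "m \<le> p y" if "\<And>t. 0 < t \<Longrightarrow> m \<le> Q t y" for m y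
    unfolding p_def using that by (intro cINF_greatest) auto
  \<comment> \<open>With weight \<open>a = s / (t + s)\<close> both \<open>a * t\<close> and
    \<open>(1 - a) * s\<close> equal \<open>t * s / (t + s)\<close>. At this step size
    \<open>u + c *\<^sub>R (y + z)\<close> is a convex combination of
    \<open>u + t *\<^sub>R y\<close> and \<open>u + s *\<^sub>R z\<close>.\<close>
  have Q_add: "Q (t * s / (t + s)) (y + z) \<le> Q t y + Q s z" if ts: "0 < t" "0 < s" for t s y z
  proof -
    define a c where "a = s / (t + s)" and "c = t * s / (t + s)"
    have a: "0 < a" "a < 1" and c: "0 < c" using ts by (auto simp: a_def c_def)
    have at: "a * t = c" and as: "(1 - a) * s = c"
      using ts by (auto simp: a_def c_def field_simps)
    have eq: "u + c *\<^sub>R (y + z) = a *\<^sub>R (u + t *\<^sub>R y) + (1 - a) *\<^sub>R (u + s *\<^sub>R z)"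
      by (simp only: scaleR_add_right scaleR_scaleR at as) (simp add: scaleR_left_diff_distrib)
    have "r (u + c *\<^sub>R (y + z)) - r u \<le> a * r (u + t *\<^sub>R y) + (1 - a) * r (u + s *\<^sub>R z) - r u"
      unfolding eq using convex[OF a] by simp
    also have "\<dots> = a * (r (u + t *\<^sub>R y) - r u) + (1 - a) * (r (u + s *\<^sub>R z) - r u)"
      by (simp add: algebra_simps)
    also have "\<dots> = (a * t) * Q t y + ((1 - a) * s) * Q s z"
      using ts by (simp add: Q_def)
    also have "\<dots> = c * (Q t y + Q s z)"
      unfolding at as by (simp add: distrib_left)
    finally show ?thesis unfolding c_def[symmetric] using c by (simp add: Q_def[of c] field_simps)
  qed
  have "sublinear p"
    unfolding sublinear_def
  proof (intro conjI allI impI)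
    fix y z
    have le: "p (y + z) \<le> Q t y + Q s z" if "0 < t" "0 < s" for t s
      using p_le[of "t * s / (t + s)" "y + z"] Q_add[OF that] that by (simp add: order_trans)
    have "p (y + z) - p z \<le> p y"
    proof (rule p_greatest)
      fix t :: real assume t: "0 < t"
      have "p (y + z) - Q t y \<le> p z" using le[OF t] by (intro p_greatest) (simp add: algebra_simps)
      then show "p (y + z) - p z \<le> Q t y" by simp
    qed
    then show "p (y + z) \<le> p y + p z" by simp
  next
    have le: "c * p y \<le> p (c *\<^sub>R y)" if c: "0 < c" for c y
    proof (rule p_greatest)
      fix t :: real assume t: "0 < t"
      have "c * p y \<le> c * Q (t * c) y" using p_le[of "t * c" y] t c by simp
      also have "\<dots> = Q t (c *\<^sub>R y)" using t c by (simp add: Q_def)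
      finally show "c * p y \<le> Q t (c *\<^sub>R y)" .
    qed
    fix c :: real and y assume "0 \<le> c"
    show "p (c *\<^sub>R y) = c * p y"
    proof (cases "c = 0")
      case True
      then show ?thesis by (simp add: p_def Q_def)
    next
      case False
      then have c: "0 < c" using \<open>0 \<le> c\<close> by simp
      then show ?thesis using le[OF c, of y] le[of "inverse c" "c *\<^sub>R y"] by (simp add: field_simps)
    qed
  qed
  then obtain f where f: "linear f" "\<And>x. f x \<le> p x"
    using hahn_banach[of p 0] by blast
  \<comment> \<open>The value at \<open>t = 1\<close> bounds the infimum \<open>p y\<close>, so the
    subgradient inequality is global without any limit.\<close>
  have f_le: "f y \<le> r (u + y) - r u" for y
    using f(2)[of y] p_le[of 1 y] by (simp add: Q_def)
  show thesis
  proof (rule that[OF f(1)])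
    show "pos_functional f"
      unfolding pos_functional_def
    proof (intro allI impI)
      fix x :: 'v assume "0 \<le> x"
      then have "r (u + - x) \<le> r u" by (intro mono) simp
      then show "0 \<le> f x" using f_le[of "- x"] by (simp add: linear_neg[OF f(1)])
    qed
    have "f (1 :: 'v) \<le> 1" using f_le[of 1] cash[of u 1] by simp
    moreover have "- f (1 :: 'v) \<le> - 1"
      using f_le[of "- 1"] cash[of u "- 1"] by (simp add: linear_neg[OF f(1)])
    ultimately show "f 1 = 1" by simp
    show "f v - r v \<le> f u - r u" for v
      using f_le[of "v - u"] by (simp add: linear_diff[OF f(1)])
  qed
qed

section \<open>Risk measures and penalties in logarithmic coordinates\<close>

lemma ereal_divide_le:
  assumes "0 < b" "ereal (a / b) \<le> P" "0 < a"
  shows "ereal a / P \<le> ereal b"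
proof (cases P)
  case (real p)
  have "0 < a / b" using assms by simp
  \<comment> \<open>The lower bound on \<open>P\<close> rules out a zero denominator; for
    \<open>P = \<infinity>\<close> the quotient is \<open>0\<close>.\<close>
  then have "0 < p" using assms(2) unfolding real ereal_less_eq by (rule less_le_trans)
  then show ?thesis using assms by (simp add: real field_simps)
qed (use assms in auto)

lemma penalty_pos:
  assumes range: "\<And>x. x \<in> int_cone \<Longrightarrow> 0 < \<rho> x"
    and proper: "\<exists>x\<in>int_cone. \<rho> x \<noteq> \<infinity>" and "l \<in> GG_dual_set"
  shows "0 < penalty \<rho> l"
proof -
  obtain f where f: "\<And>u. l (am_exp u) = exp (f u)" using GG_dual_setD[OF assms(3)] by blast
  obtain x where x: "x \<in> int_cone" "\<rho> x \<noteq> \<infinity>" using proper by blast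
  obtain u where u: "x = am_exp u" using x(1) by (rule am_exp_surj)
  have "0 < \<rho> x" using x(1) by (rule range)
  then have "0 < ereal (l x) / \<rho> x" using x(2) f[of u] u by (cases "\<rho> x") auto
  also have "\<dots> \<le> penalty \<rho> l" unfolding penalty_def using x(1) by (rule SUP_upper)
  finally show ?thesis .
qed

lemma log_risk_measure:
  fixes \<rho> :: "'v::am_algebra \<Rightarrow> ereal"
  assumes \<rho>: "return_risk_measure \<rho>" and proper: "\<exists>x\<in>int_cone. \<rho> x \<noteq> \<infinity>"
  obtains r where "\<And>u. \<rho> (am_exp u) = ereal (exp (r u))" "\<And>u v. u \<le> v \<Longrightarrow> r u \<le> r v"
    "\<And>u c. r (u + c *\<^sub>R 1) = r u + c"
proof -
  have pos: "\<And>x. x \<in> int_cone \<Longrightarrow> 0 < \<rho> x"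
    and mono: "\<And>x y. x \<in> int_cone \<Longrightarrow> y \<in> int_cone \<Longrightarrow> x \<le> y \<Longrightarrow> \<rho> x \<le> \<rho> y"
    and hom: "\<And>x c. x \<in> int_cone \<Longrightarrow> 0 < c \<Longrightarrow> \<rho> (c *\<^sub>R x) = ereal c * \<rho> x"
    using \<rho> by (auto simp: return_risk_measure_def)
  obtain w where w: "\<rho> (am_exp w) \<noteq> \<infinity>" using proper am_exp_surj by metis
  have fin: "\<rho> (am_exp u) \<noteq> \<infinity>" for u
  proof -
    \<comment> \<open>Every \<open>u\<close> lies below a translate of the point \<open>w\<close> of
      finite risk, and under \<open>am_exp\<close> this translation becomes a scaling, which keeps
      the risk finite.\<close>
    have "u \<le> w + norm (u - w) *\<^sub>R 1" using le_norm[of "u - w"] by (simp only: diff_le_eq add.commute)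
    then have "\<rho> (am_exp u) \<le> \<rho> (am_exp (w + norm (u - w) *\<^sub>R 1))" by (intro mono) auto
    also have "\<dots> = ereal (exp (norm (u - w))) * \<rho> (am_exp w)"
      by (simp add: am_exp_add_scaleR_one hom)
    finally show ?thesis using w pos[of "am_exp w"] by (cases "\<rho> (am_exp w)") auto
  qed
  define r where "r u = ln (real_of_ereal (\<rho> (am_exp u)))" for u
  have r: "\<rho> (am_exp u) = ereal (exp (r u))" for u
    using fin[of u] pos[of "am_exp u"] by (cases "\<rho> (am_exp u)") (auto simp: r_def)
  show thesis
  proof (rule that[OF r])
    show "r u \<le> r v" if "u \<le> v" for u v
      using mono[of "am_exp u" "am_exp v"] that by (simp add: r)
    show "r (u + c *\<^sub>R 1) = r u + c" for u c
    proof -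
      have "ereal (exp (r (u + c *\<^sub>R 1))) = ereal (exp (r u + c))"
        unfolding r[symmetric] am_exp_add_scaleR_one by (simp add: hom r exp_add)
      then show ?thesis by simp
    qed
  qed
qed

lemma GG_convex_log:
  assumes "GG_convex \<rho>" "\<And>u. \<rho> (am_exp u) = ereal (exp (r u))" "0 < t" "t < 1"
  shows "r (t *\<^sub>R u + (1 - t) *\<^sub>R v) \<le> t * r u + (1 - t) * r v"
proof -
  have "\<rho> (am_power (am_exp u) t * am_power (am_exp v) (1 - t))
      \<le> ereal_power (\<rho> (am_exp u)) t * ereal_power (\<rho> (am_exp v)) (1 - t)"
    using assms(1,3,4) by (simp add: GG_convex_def)
  then have "exp (r (t *\<^sub>R u + (1 - t) *\<^sub>R v)) \<le> exp (t * r u) * exp ((1 - t) * r v)"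
    using assms(3,4) by (simp add: am_power_am_exp am_exp_mult assms(2) ereal_power_def powr_def)
  then show ?thesis by (simp flip: exp_add)
qed

text \<open>The logarithm of the penalty is thus the Fenchel conjugate of \<open>r\<close> at
  \<open>f\<close>, and \<open>f\<close> is a subgradient at \<open>u\<close> exactly when the
  supremum is attained at \<open>u\<close>.\<close>

lemma penalty_log:
  fixes \<rho> :: "'v::am_algebra \<Rightarrow> ereal"
  assumes "\<And>u. \<rho> (am_exp u) = ereal (exp (r u))" "\<And>u. l (am_exp u) = exp (f u)"
  shows "penalty \<rho> l = (SUP u. ereal (exp (f u - r u)))"
proof -
  have eq: "(int_cone :: 'v set) = range am_exp" by (auto elim: am_exp_surj)
  show ?thesis unfolding penalty_def eq image_image by (simp add: assms exp_diff)
qed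

section \<open>The two implications and the acceptance set\<close>

lemma representation_if_GG_convex:
  fixes \<rho> :: "'v::am_algebra \<Rightarrow> ereal"
  assumes \<rho>: "return_risk_measure \<rho>" "GG_convex \<rho>" and proper: "\<exists>x\<in>int_cone. \<rho> x \<noteq> \<infinity>"
    and x: "x \<in> int_cone"
  shows "\<exists>l\<in>GG_dual_set. \<rho> x = ereal (l x) / penalty \<rho> l \<and>
    (\<forall>l'\<in>GG_dual_set. ereal (l' x) / penalty \<rho> l' \<le> ereal (l x) / penalty \<rho> l)"
proof -
  obtain r where r: "\<And>u. \<rho> (am_exp u) = ereal (exp (r u))" "\<And>u v. u \<le> v \<Longrightarrow> r u \<le> r v"
    "\<And>u c. r (u + c *\<^sub>R 1) = r u + c"
    using log_risk_measure[OF \<rho>(1) proper] by blast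
  obtain u where u: "x = am_exp u" using x by (rule am_exp_surj)
  obtain f where f: "linear f" "pos_functional f" "f 1 = 1" "\<And>v. f v - r v \<le> f u - r u"
    using subgradient_exists[of r u, OF r(2,3) GG_convex_log[OF \<rho>(2) r(1)]] by blast
  define l where "l = (\<lambda>x\<in>int_cone. exp (f (am_log x)))"
  have l: "l \<in> GG_dual_set" unfolding l_def using f(1-3) by (rule GG_dual_setI)
  have "penalty \<rho> l = (SUP u. ereal (exp (f u - r u)))"
    using r(1) by (rule penalty_log) (simp add: l_def)
  \<comment> \<open>The subgradient inequality says that the supremum is attained at
    \<open>u\<close>, which makes the quotient at \<open>x\<close> equal to
    \<open>exp (r u)\<close>.\<close>
  also have "\<dots> = ereal (exp (f u - r u))"
    using f(4) by (intro antisym SUP_least SUP_upper) auto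
  finally have eq: "ereal (l x) / penalty \<rho> l = \<rho> x" by (simp add: u r(1) l_def exp_diff)
  have "ereal (l' x) / penalty \<rho> l' \<le> \<rho> x" if l': "l' \<in> GG_dual_set" for l'
  proof -
    obtain f' where f': "\<And>u. l' (am_exp u) = exp (f' u)" using GG_dual_setD[OF l'] by blast
    \<comment> \<open>The Fenchel--Young inequality: \<open>x\<close> is itself one of the points
      over which the penalty takes its supremum.\<close>
    have "ereal (exp (f' u) / exp (r u)) \<le> penalty \<rho> l'"
      unfolding penalty_log[of \<rho> r l' f', OF r(1) f'] exp_diff[symmetric] by (rule SUP_upper) simp
    then show ?thesis unfolding u f' r(1) by (intro ereal_divide_le) auto
  qed
  then show ?thesis using l eq by (intro bexI[of _ l]) auto
qed

text \<open>An attained maximum supplies, at each \<open>u\<close>, an affine function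
  \<open>f - a\<close> that equals the logarithm of \<open>\<rho> (am_exp u)\<close> there and stays
  below it everywhere. An upper bound on \<open>\<rho>\<close> at a point follows by taking the
  functional that touches there: at the smaller element for monotonicity, at the geometric mean for
  GG-convexity.\<close>

lemma GG_convex_if_representation:
  fixes \<rho> :: "'v::am_algebra \<Rightarrow> ereal"
  assumes range: "\<And>x. x \<in> int_cone \<Longrightarrow> 0 < \<rho> x" and proper: "\<exists>x\<in>int_cone. \<rho> x \<noteq> \<infinity>"
    and rep: "\<And>x. x \<in> int_cone \<Longrightarrow> \<exists>l\<in>GG_dual_set. \<rho> x = ereal (l x) / penalty \<rho> l \<and>
      (\<forall>l'\<in>GG_dual_set. ereal (l' x) / penalty \<rho> l' \<le> ereal (l x) / penalty \<rho> l)"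
  shows "return_risk_measure \<rho>" "GG_convex \<rho>"
proof -
  have max: "\<exists>f a. linear f \<and> pos_functional f \<and> f 1 = 1 \<and>
      \<rho> (am_exp u) = ereal (exp (f u - a)) \<and> (\<forall>v. ereal (exp (f v - a)) \<le> \<rho> (am_exp v))" for u
  proof -
    obtain l where l: "l \<in> GG_dual_set" "\<rho> (am_exp u) = ereal (l (am_exp u)) / penalty \<rho> l"
      using rep[of "am_exp u"] by auto
    obtain f where f: "linear f" "pos_functional f" "f 1 = 1" "\<And>u. l (am_exp u) = exp (f u)"
      using GG_dual_setD[OF l(1)] by blast
    have "0 < penalty \<rho> l" using range proper l(1) by (rule penalty_pos)
    \<comment> \<open>An infinite penalty would make the quotient, and with it
      \<open>\<rho> (am_exp u)\<close>, zero.\<close>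
    moreover have "penalty \<rho> l \<noteq> \<infinity>" using l(2) range[of "am_exp u"] by auto
    ultimately obtain b where b: "0 < b" "penalty \<rho> l = ereal b" by (cases "penalty \<rho> l") auto
    have eq: "ereal (l (am_exp v)) / penalty \<rho> l = ereal (exp (f v - ln b))" for v
      using b by (simp add: f(4) exp_diff)
    have "ereal (exp (f v - ln b)) \<le> \<rho> (am_exp v)" for v
      using rep[of "am_exp v"] l(1) unfolding eq[symmetric] by auto
    then show ?thesis using f(1-3) l(2) unfolding eq by blast
  qed
  show "return_risk_measure \<rho>"
    unfolding return_risk_measure_def
  proof (intro conjI ballI allI impI)
    fix x :: 'v assume "x \<in> int_cone"
    then show "0 < \<rho> x" by (rule range)
  next
    fix x y :: 'v assume "x \<in> int_cone" "y \<in> int_cone" and "x \<le> y"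
    then obtain u v where uv: "x = am_exp u" "y = am_exp v" by (metis am_exp_surj)
    with \<open>x \<le> y\<close> have "u \<le> v" by simp
    obtain f a where f: "linear f" "pos_functional f" "\<rho> (am_exp u) = ereal (exp (f u - a))"
      "\<And>v. ereal (exp (f v - a)) \<le> \<rho> (am_exp v)" using max[of u] by blast
    have "ereal (exp (f u - a)) \<le> ereal (exp (f v - a))"
      using pos_functional_mono[OF f(1,2) \<open>u \<le> v\<close>] by simp
    also have "\<dots> \<le> \<rho> (am_exp v)" by (rule f(4))
    finally show "\<rho> x \<le> \<rho> y" by (simp only: uv f(3))
  next
    \<comment> \<open>The functional touching at \<open>u\<close> gives one half of homogeneity; the
      other half is the same inequality for \<open>- d\<close> at the translated point.\<close>
    have le: "ereal (exp d) * \<rho> (am_exp u) \<le> \<rho> (am_exp (u + d *\<^sub>R 1))" for u d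
    proof -
      obtain f a where f: "linear f" "f 1 = 1" "\<rho> (am_exp u) = ereal (exp (f u - a))"
        "\<And>v. ereal (exp (f v - a)) \<le> \<rho> (am_exp v)" using max[of u] by blast
      have "exp d * exp (f u - a) = exp (f (u + d *\<^sub>R 1) - a)"
        by (simp add: linear_add[OF f(1)] linear_scale[OF f(1)] f(2) flip: exp_add)
      then show ?thesis using f(4)[of "u + d *\<^sub>R 1"] by (simp add: f(3))
    qed
    fix x :: 'v and c :: real assume x: "x \<in> int_cone" and c: "0 < c"
    obtain u where u: "x = am_exp u" using x by (rule am_exp_surj)
    obtain g b where b: "\<rho> (am_exp u) = ereal (exp (g u - b))"
      using max[of u] by blast
    obtain g' b' where b': "\<rho> (am_exp (u + ln c *\<^sub>R 1)) = ereal (exp (g' (u + ln c *\<^sub>R 1) - b'))"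
      using max[of "u + ln c *\<^sub>R 1"] by blast
    have "ereal c * \<rho> (am_exp u) \<le> \<rho> (am_exp (u + ln c *\<^sub>R 1))" using le[of "ln c" u] c by simp
    moreover have "\<rho> (am_exp (u + ln c *\<^sub>R 1)) \<le> ereal c * \<rho> (am_exp u)"
    proof -
      have "ereal (inverse c) * \<rho> (am_exp (u + ln c *\<^sub>R 1)) \<le> \<rho> (am_exp u)"
        using le[of "- ln c" "u + ln c *\<^sub>R 1"] c by (simp add: exp_minus)
      then show ?thesis using c unfolding b b' by (simp add: field_simps)
    qed
    moreover have "c *\<^sub>R x = am_exp (u + ln c *\<^sub>R 1)" using c by (simp add: u am_exp_add_scaleR_one)
    ultimately show "\<rho> (c *\<^sub>R x) = ereal c * \<rho> x" unfolding u by (simp add: antisym)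
  qed
  show "GG_convex \<rho>"
    unfolding GG_convex_def
  proof (intro ballI allI impI)
    fix x y :: 'v and t :: real assume "x \<in> int_cone" "y \<in> int_cone" and t: "0 < t \<and> t < 1"
    then obtain u v where uv: "x = am_exp u" "y = am_exp v" by (metis am_exp_surj)
    let ?w = "t *\<^sub>R u + (1 - t) *\<^sub>R v"
    obtain f a where f: "linear f" "\<rho> (am_exp ?w) = ereal (exp (f ?w - a))"
      "\<And>v. ereal (exp (f v - a)) \<le> \<rho> (am_exp v)" using max[of ?w] by blast
    obtain b where b: "\<rho> (am_exp u) = ereal (exp b)" using max[of u] by blast
    obtain b' where b': "\<rho> (am_exp v) = ereal (exp b')" using max[of v] by blast
    have "f ?w - a = t * (f u - a) + (1 - t) * (f v - a)"
      unfolding linear_add[OF f(1)] linear_scale[OF f(1)] by (simp add: algebra_simps)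
    also have "\<dots> \<le> t * b + (1 - t) * b'"
      using f(3)[of u] f(3)[of v] t unfolding b b' by (intro add_mono mult_left_mono) auto
    finally have "exp (f ?w - a) \<le> exp (t * b) * exp ((1 - t) * b')" by (simp flip: exp_add)
    then show "\<rho> (am_power x t * am_power y (1 - t)) \<le> ereal_power (\<rho> x) t * ereal_power (\<rho> y) (1 - t)"
      using t unfolding uv b b'
      by (simp add: am_power_am_exp am_exp_mult f(2) ereal_power_def powr_def)
  qed
qed

text \<open>Both \<open>l\<close> and \<open>\<rho>\<close> are positively homogeneous, so
  \<open>l x / \<rho> x\<close> is unchanged when \<open>x\<close> is scaled to
  \<open>\<rho> x = 1\<close>. In logarithmic coordinates this scaling is the translation of
  \<open>u\<close> by \<open>- r u\<close>, and \<open>f 1 = 1\<close> accounts for the change of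
  \<open>f\<close>.\<close>

lemma penalty_eq_SUP_acceptance_set:
  fixes \<rho> :: "'v::am_algebra \<Rightarrow> ereal"
  assumes \<rho>: "return_risk_measure \<rho>" and proper: "\<exists>x\<in>int_cone. \<rho> x \<noteq> \<infinity>"
    and "l \<in> GG_dual_set"
  shows "penalty \<rho> l = (SUP x\<in>acceptance_set \<rho>. ereal (l x))"
proof -
  obtain r where r: "\<And>u. \<rho> (am_exp u) = ereal (exp (r u))" "\<And>u v. u \<le> v \<Longrightarrow> r u \<le> r v"
    "\<And>u c. r (u + c *\<^sub>R 1) = r u + c"
    using log_risk_measure[OF \<rho> proper] by blast
  obtain f where f: "linear f" "pos_functional f" "f 1 = 1" "\<And>u. l (am_exp u) = exp (f u)"
    using GG_dual_setD[OF assms(3)] by blast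
  show ?thesis
    unfolding penalty_log[of \<rho> r l f, OF r(1) f(4)]
  proof (rule antisym)
    show "(SUP u. ereal (exp (f u - r u))) \<le> (SUP x\<in>acceptance_set \<rho>. ereal (l x))"
    proof (rule SUP_least)
      fix u :: 'v
      have "am_exp (u + (- r u) *\<^sub>R 1) \<in> acceptance_set \<rho>"
        unfolding acceptance_set_def mem_Collect_eq r(1,3) by simp
      moreover have "l (am_exp (u + (- r u) *\<^sub>R 1)) = exp (f u - r u)"
        by (simp only: f(4) linear_add[OF f(1)] linear_scale[OF f(1)] f(3)) simp
      ultimately show "ereal (exp (f u - r u)) \<le> (SUP x\<in>acceptance_set \<rho>. ereal (l x))"
        by (intro SUP_upper2[of "am_exp (u + (- r u) *\<^sub>R 1)"]) auto
    qed
    show "(SUP x\<in>acceptance_set \<rho>. ereal (l x)) \<le> (SUP u. ereal (exp (f u - r u)))"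
    proof (rule SUP_least)
      fix x assume x: "x \<in> acceptance_set \<rho>"
      then obtain u where u: "x = am_exp u" by (auto simp: acceptance_set_def elim: am_exp_surj)
      have "r u \<le> 0" using x by (simp add: acceptance_set_def u r(1) one_ereal_def)
      then show "ereal (l x) \<le> (SUP u. ereal (exp (f u - r u)))"
        by (intro SUP_upper2[of u]) (auto simp: u f(4))
    qed
  qed
qed

theorem theorem3p3:
  fixes \<rho> :: "'v::am_algebra \<Rightarrow> ereal"
  assumes infinite_dim: "\<not> (\<exists>B::'v set. finite B \<and> span B = UNIV)"
    and range: "\<And>x. x \<in> int_cone \<Longrightarrow> 0 < \<rho> x"
    and proper: "\<exists>x\<in>int_cone. \<rho> x \<noteq> \<infinity>"
  shows "((return_risk_measure \<rho> \<and> GG_convex \<rho>) \<longleftrightarrow>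
      (\<forall>x\<in>int_cone. \<exists>l\<in>GG_dual_set.
         \<rho> x = ereal (l x) / penalty \<rho> l \<and>
         (\<forall>l'\<in>GG_dual_set. ereal (l' x) / penalty \<rho> l' \<le> ereal (l x) / penalty \<rho> l))) \<and>
    (\<forall>l\<in>GG_dual_set. 0 < penalty \<rho> l) \<and>
    (return_risk_measure \<rho> \<and> GG_convex \<rho> \<longrightarrow>
      (\<forall>l\<in>GG_dual_set. penalty \<rho> l = (SUP x\<in>acceptance_set \<rho>. ereal (l x))))"
proof (intro conjI iffI ballI impI)
  fix x :: 'v assume "return_risk_measure \<rho> \<and> GG_convex \<rho>" "x \<in> int_cone"
  then show "\<exists>l\<in>GG_dual_set. \<rho> x = ereal (l x) / penalty \<rho> l \<and>
      (\<forall>l'\<in>GG_dual_set. ereal (l' x) / penalty \<rho> l' \<le> ereal (l x) / penalty \<rho> l)"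
    using representation_if_GG_convex proper by blast
next
  assume *: "\<forall>x\<in>int_cone. \<exists>l\<in>GG_dual_set. \<rho> x = ereal (l x) / penalty \<rho> l \<and>
      (\<forall>l'\<in>GG_dual_set. ereal (l' x) / penalty \<rho> l' \<le> ereal (l x) / penalty \<rho> l)"
  show "return_risk_measure \<rho>"
    by (rule GG_convex_if_representation(1)) (use * range proper in auto)
  show "GG_convex \<rho>"
    by (rule GG_convex_if_representation(2)) (use * range proper in auto)
next
  fix l :: "'v \<Rightarrow> real" assume "l \<in> GG_dual_set"
  with range proper show "0 < penalty \<rho> l" by (rule penalty_pos)
next
  fix l :: "'v \<Rightarrow> real" assume "return_risk_measure \<rho> \<and> GG_convex \<rho>" "l \<in> GG_dual_set"
  then show "penalty \<rho> l = (SUP x\<in>acceptance_set \<rho>. ereal (l x))"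
    using penalty_eq_SUP_acceptance_set proper by blast
qed

end
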